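(* Let $d\ge1$, $\beta\in(1,(d+2)/d)$, and let $\widetilde p_n$ be a suitable continuous (density) estimate of the empirical measure of an i.i.d. sample in $\mathbb{R}^d$. Then the generalized Hellinger estimators (of order $\beta$) of the location parameter $\boldsymbol{\mu}$ and scale parameter $\boldsymbol{\Sigma}=(\sigma_{ij})$ of the $d$-dimensional Cauchy distribution with index $\beta$ are given by $$\widehat{\boldsymbol{\mu}}=\mathbb{E}_{\widetilde p_n^{(\beta)}}[\mathbf{X}],\qquad \widehat{\sigma_{ij}}=\Big(\mathbb{E}_{\widetilde p_n^{(\beta)}}[X_iX_j]-\widehat{\mu_i}\,\widehat{\mu_j}\Big)\Big/\Big(\frac{\nu}{\nu-2}\Big),\quad i,j\in\{1,\dots,d\},\ i\le j,$$ where $\mathbf{X}=[X_1,\dots,X_d]^\top$ and $\nu>2$ is determined by $1/\beta=1-\frac{2}{\nu+d}$.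
   Context: Cauchy distributions with index $\beta\in(1,(d+2)/d)$: with $\nu$ defined by $1/\beta=1-\frac{2}{\nu+d}$ (so $\nu>2$), for $\boldsymbol{\mu}\in\mathbb{R}^d$ and $\boldsymbol{\Sigma}=(\sigma_{ij})$ symmetric positive definite of order $d$, $$q_\eta(\mathbf{x})=M_{\eta,\beta}\big[1+\tfrac1\nu(\mathbf{x}-\boldsymbol{\mu})^\top\boldsymbol{\Sigma}^{-1}(\mathbf{x}-\boldsymbol{\mu})\big]^{\frac1{1-\beta}},\quad\mathbf{x}\in\mathbb{R}^d,$$ with $M_{\eta,\beta}$ the normalizing constant and unknown parameter $\eta=[\mu_i,\sigma_{ij}]^\top_{i\le j}$ ($\beta$ known). (It is the escort measure $p_\theta^{(1/\beta)}$ of the $d$-dimensional Student distribution $p_\theta$ with $\nu$ degrees of freedom, location $\boldsymbol{\mu}$ and scale $\boldsymbol{\Sigma}$.) For a density $p$, $p^{(\beta)}=p^\beta/\int p^\beta$. The generalized Hellinger estimator of order $\beta$ is the parameter value $\eta$ solving $$\int\widetilde p_n(\mathbf{x})^\beta q_\eta(\mathbf{x})^{1-\beta}\,\nabla_\eta\ln q_\eta(\mathbf{x})\,d\mathbf{x}=0.$$ All integrals involved are assumed well defined (finite); in particular $\widetilde p_n^{(\beta)}$ exists and has finite second moments. *)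

theory Defs
  imports "HOL-Analysis.Analysis" "HOL-Library.Uprod"
begin

instance uprod :: (finite) finite
  by standard simp

definition gradient :: "('a::real_inner \<Rightarrow> real) \<Rightarrow> 'a \<Rightarrow> 'a" where
  "gradient f x = (THE D. GDERIV f x :> D)"

definition pos_def :: "real ^ 'n ^ 'n \<Rightarrow> bool" where
  "pos_def A \<longleftrightarrow> transpose A = A \<and> (\<forall>x. x \<noteq> 0 \<longrightarrow> x \<bullet> (A *v x) > 0)"

definition escort_density :: "real \<Rightarrow> ('a::euclidean_space \<Rightarrow> real) \<Rightarrow> 'a \<Rightarrow> real" where
  "escort_density \<beta> p x = p x powr \<beta> / (LINT y|lborel. p y powr \<beta>)"

definition escort_measure :: "real \<Rightarrow> ('a::euclidean_space \<Rightarrow> real) \<Rightarrow> 'a measure" where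
  "escort_measure \<beta> p = density lborel (\<lambda>x. ennreal (escort_density \<beta> p x))"

(* The parameter vector [mu_i, sigma_ij], i <= j, has CARD('n) location coordinates (Inl) and
   one scale coordinate (Inr) for each unordered pair {i, j}, where i = j is allowed: an
   unordered pair is the same as an index pair with i <= j.  So the coordinates are independent,
   the off-diagonal sigma_ij = sigma_ji counts once, and the scale matrix is always symmetric. *)
type_synonym 'n param = "real ^ ('n + 'n uprod)"

definition location :: "('n::finite) param \<Rightarrow> real ^ 'n" where
  "location \<eta> = (\<chi> i. \<eta> $ Inl i)"

definition scale_matrix :: "('n::finite) param \<Rightarrow> real ^ 'n ^ 'n" where
  "scale_matrix \<eta> = (\<chi> i j. \<eta> $ Inr (Upair i j))"

definition cauchy_kernel :: "real \<Rightarrow> real \<Rightarrow> ('n::finite) param \<Rightarrow> real ^ 'n \<Rightarrow> real" where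
  "cauchy_kernel \<beta> \<nu> \<eta> x =
     (1 + 1 / \<nu> * ((x - location \<eta>) \<bullet> (matrix_inv (scale_matrix \<eta>) *v (x - location \<eta>))))
       powr (1 / (1 - \<beta>))"

definition cauchy_density :: "real \<Rightarrow> real \<Rightarrow> ('n::finite) param \<Rightarrow> real ^ 'n \<Rightarrow> real" where
  "cauchy_density \<beta> \<nu> \<eta> x =
     1 / (LINT y|lborel. cauchy_kernel \<beta> \<nu> \<eta> y) * cauchy_kernel \<beta> \<nu> \<eta> x"

(* has_bochner_integral also asserts integrability: the bare equation "integral = 0" would hold
   by convention for a non-integrable integrand. *)
definition generalized_hellinger_estimator ::
  "real \<Rightarrow> ('a::euclidean_space \<Rightarrow> real) \<Rightarrow> ('e::euclidean_space \<Rightarrow> 'a \<Rightarrow> real) \<Rightarrow> 'e set \<Rightarrow> 'e \<Rightarrow> bool" where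
  "generalized_hellinger_estimator \<beta> p q \<Theta> \<eta> \<longleftrightarrow>
     \<eta> \<in> \<Theta> \<and>
     has_bochner_integral lborel
       (\<lambda>x. (p x powr \<beta> * q \<eta> x powr (1 - \<beta>)) *\<^sub>R gradient (\<lambda>\<eta>'. ln (q \<eta>' x)) \<eta>) 0"

end

theory Submission
  imports Defs "HOL-Probability.Probability_Measure"
begin

text \<open>
  Linear change of variables gives the normalizing constant as a constant times the square root of
  the determinant of the scale matrix, so that near a positive definite scale matrix the logarithm
  of the density is an explicit differentiable function of the parameter. The power
  \<open>1 - \<beta>\<close> of the density cancels the exponent of the kernel, which makes the weighted
  score in each direction a polynomial of degree two in the sample point. Its mean under the escort
  measure therefore involves the first two moments only. The location directions force the mean, and
  the scale directions force the covariance \<open>S\<close> to be a multiple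
  \<open>S = \<kappa> \<Sigma>\<close>; taking the trace of \<open>\<Sigma>\<^sup>-\<^sup>1 S\<close>
  determines \<open>\<kappa> = \<nu> / (\<nu> - 2)\<close>.
  Conversely the moment equations make the scale matrix positive definite, since the escort measure
  gives no mass to hyperplanes.
\<close>

subsection \<open>Linear change of variables\<close>

text \<open>The estimating equation contains \<open>gradient\<close>, a definite description, so
  nothing can be computed before the log density is known to be differentiable in the parameter. The
  obstacle is the normalizing constant, an integral that depends on the parameter; evaluating it in
  closed form replaces differentiation under the integral sign by differentiation of a determinant.
  The constants come from one relation: with d the dimension, the link between \<beta> and \<nu>
  reads \<open>(\<nu> + d - 2) * (\<beta> - 1) = 2\<close>. Hence the kernel has exponent
  \<open>- (\<nu> + d - 2) / 2\<close>, the source of the coefficient in \<open>score\<close>, and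
  the bound on \<beta> becomes \<open>\<nu> > 2\<close>, which is also the condition for the kernel
  to be integrable. In the trace step the unknown multiple k satisfies
  \<open>k * (\<nu> + d - 2) = \<nu> + k * d\<close>; the dimension cancels, and this is why the
  final factor does not depend on it.\<close>

lemma bij_betw_axis_Basis: "bij_betw (\<lambda>i. axis i (1::real)) UNIV (Basis :: (real^'n) set)"
  by (auto simp: bij_betw_def inj_on_def axis_eq_axis Basis_vec_def)

lemma emeasure_lborel_shear_vimage:
  fixes m n :: "'n::finite"
  defines "f \<equiv> \<lambda>x::real^'n. \<chi> i. if i = m then x $ m + x $ n else x $ i"
  assumes "m \<noteq> n" "A \<in> sets borel"
  shows "emeasure lborel (f -` A) = emeasure lborel A"
proof -
  define g where "g \<equiv> \<lambda>x::real^'n. \<chi> i. if i = m then x $ m - x $ n else x $ i"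
  have lin_f: "linear f" and lin_g: "linear g"
    by (auto simp: f_def g_def linear_iff vec_eq_iff algebra_simps)
  then have meas [measurable]: "f \<in> borel_measurable borel" "g \<in> borel_measurable borel"
    by (auto intro!: borel_measurable_continuous_onI linear_continuous_on simp: linear_linear)
  have gf: "g (f x) = x" and fg: "f (g x) = x" for x
    using \<open>m \<noteq> n\<close> by (auto simp: f_def g_def vec_eq_iff)
  have g_vimage: "g -` A = f ` A" for A
    using gf fg by (auto simp: image_iff) metis
  have cbox: "measure lebesgue (f ` cbox a b) = 1 * measure lebesgue (cbox a b)" for a b
  proof (cases "cbox a b = {}")
    case False
    \<comment> \<open>\<open>measure_shear_interval\<close> wants a nonnegative lower corner in
      coordinate \<open>n\<close>. Translating by \<open>v\<close> makes that coordinate 0, and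
      translations preserve measure before and after the shear.\<close>
    define v where "v = axis n (- (a $ n))"
    have "f ` cbox (v + a) (v + b) = (+) (f v) ` f ` cbox a b"
      using linear_add[OF lin_f] by (auto simp: image_image cbox_translation)
    then have "measure lebesgue (f ` cbox a b) = measure lebesgue (f ` cbox (v + a) (v + b))"
      by (simp only: measure_translation)
    also have "\<dots> = measure lebesgue (cbox (v + a) (v + b))"
      unfolding f_def using False \<open>m \<noteq> n\<close>
      by (intro measure_shear_interval) (auto simp: v_def cbox_translation)
    also have "\<dots> = measure lebesgue (cbox a b)"
      by (metis cbox_translation measure_translation)
    finally show ?thesis by simp
  qed simp
  \<comment> \<open>Invariance is proved for the inverse shear \<open>g\<close>, because its
    preimages are the images under \<open>f\<close> that the interval lemma measures. Evaluating the
    image measure on a preimage under \<open>f\<close> then cancels the two maps.\<close>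
  have "lborel = distr lborel borel g"
  proof (rule lborel_eqI)
    fix l u :: "real^'n" assume le: "\<And>b. b \<in> Basis \<Longrightarrow> l \<bullet> b \<le> u \<bullet> b"
    have "f ` box l u \<in> lmeasurable \<and> 1 * measure lebesgue (box l u) = measure lebesgue (f ` box l u)"
      by (rule measure_linear_sufficient[OF lin_f _ cbox]) simp
    then have "emeasure lebesgue (f ` box l u) = emeasure lebesgue (box l u)"
      by (simp add: emeasure_eq_measure2 del: measure_lborel_box)
    moreover have "f ` box l u \<in> sets borel"
      unfolding g_vimage[symmetric] using measurable_sets_borel[OF meas(2)] by simp
    ultimately have "emeasure lborel (f ` box l u) = emeasure lborel (box l u)"
      by simp
    then show "emeasure (distr lborel borel g) (box l u) = (\<Prod>b\<in>Basis. (u - l) \<bullet> b)"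
      using le by (simp add: emeasure_distr g_vimage emeasure_lborel_box)
  qed simp
  then have "emeasure lborel (f -` A) = emeasure (distr lborel borel g) (f -` A)"
    by simp
  also have "\<dots> = emeasure lborel (g -` f -` A)"
    using measurable_sets_borel[OF meas(1) assms(3)] by (simp add: emeasure_distr)
  also have "g -` f -` A = A"
    using fg by auto
  finally show ?thesis .
qed

lemma emeasure_lborel_swap_vimage:
  fixes m n :: "'n::finite"
  defines "f \<equiv> \<lambda>x::real^'n. \<chi> i. x $ Transposition.transpose m n i"
  assumes "A \<in> sets borel"
  shows "emeasure lborel (f -` A) = emeasure lborel A"
proof -
  have "linear f"
    by (auto simp: f_def linear_iff vec_eq_iff algebra_simps)
  then have meas [measurable]: "f \<in> borel_measurable borel"
    by (auto intro!: borel_measurable_continuous_onI linear_continuous_on simp: linear_linear)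
  have "lborel = distr lborel borel f"
  proof (rule lborel_eqI)
    fix l u :: "real^'n" assume le: "\<And>b. b \<in> Basis \<Longrightarrow> l \<bullet> b \<le> u \<bullet> b"
    have le': "l $ i \<le> u $ i" for i
      using le[of "axis i 1"] by (auto simp: inner_axis axis_in_Basis_iff)
    have "f -` box l u = box (f l) (f u)"
      by (auto simp: f_def mem_box_cart) (metis transpose_involutory)+
    moreover have "emeasure lborel (box (f l) (f u)) = ennreal (\<Prod>b\<in>Basis. (f u - f l) \<bullet> b)"
      using le' by (subst emeasure_lborel_box) (auto simp: f_def Basis_vec_def inner_axis)
    moreover have "(\<Prod>b\<in>Basis. (f u - f l) \<bullet> b) = (\<Prod>b\<in>Basis. (u - l) \<bullet> b)"
      using prod.permute[OF permutes_swap_id, of m UNIV n "\<lambda>i. (u - l)$i"]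
      by (simp add: prod.reindex_bij_betw[OF bij_betw_axis_Basis, symmetric] f_def inner_axis o_def)
    ultimately show "emeasure (distr lborel borel f) (box l u) = (\<Prod>b\<in>Basis. (u - l) \<bullet> b)"
      by (simp add: emeasure_distr)
  qed simp
  then have "emeasure lborel A = emeasure (distr lborel borel f) A"
    by simp
  also have "\<dots> = emeasure lborel (f -` A)"
    using assms(2) by (simp add: emeasure_distr)
  finally show ?thesis by simp
qed

lemma det_matrix_shear:
  fixes m n :: "'n::finite"
  assumes "m \<noteq> n"
  shows "det (matrix (\<lambda>x::real^'n. \<chi> i. if i = m then x $ m + x $ n else x $ i)) = 1"
proof -
  have "matrix (\<lambda>x::real^'n. \<chi> i. if i = m then x $ m + x $ n else x $ i)
      = (\<chi> k. if k = m then row m (mat 1) + 1 *s row n (mat 1) else row k (mat 1))"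
    by (auto simp: matrix_def vec_eq_iff row_def mat_def axis_def)
  then show ?thesis
    by (simp only: det_row_operation[OF assms] det_I)
qed

lemma det_matrix_swap:
  fixes m n :: "'n::finite"
  shows "\<bar>det (matrix (\<lambda>x::real^'n. \<chi> i. x $ Transposition.transpose m n i))\<bar> = 1"
proof -
  have "matrix (\<lambda>x::real^'n. \<chi> i. x $ Transposition.transpose m n i) = (\<chi> i. mat 1 $ Transposition.transpose m n i)"
    by (auto simp: matrix_def vec_eq_iff mat_def axis_def)
  then show ?thesis
    by (simp only: det_permute_rows[OF permutes_swap_id[OF UNIV_I UNIV_I]]) (simp add: sign_swap_id abs_mult)
qed

lemma emeasure_lborel_linear_vimage:
  fixes f :: "real^'n \<Rightarrow> real^'n"
  assumes "linear f" "det (matrix f) \<noteq> 0" "A \<in> sets borel"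
  shows "ennreal \<bar>det (matrix f)\<bar> * emeasure lborel (f -` A) = emeasure lborel A"
proof -
  \<comment> \<open>The determinant condition and the quantifier over Borel sets are both part of
    the induction formula. For a composite the condition passes to each factor and the outer set is
    replaced by a preimage; for a map with a vanishing coordinate the condition fails.\<close>
  have "det (matrix f) \<noteq> 0 \<longrightarrow>
      (\<forall>A\<in>sets borel. ennreal \<bar>det (matrix f)\<bar> * emeasure lborel (f -` A) = emeasure lborel A)"
  proof (rule induct_linear_elementary[OF \<open>linear f\<close>])
    fix f g :: "real^'n \<Rightarrow> real^'n"
    assume lin: "linear f" "linear g"
      and f: "det (matrix f) \<noteq> 0 \<longrightarrow>
        (\<forall>A\<in>sets borel. ennreal \<bar>det (matrix f)\<bar> * emeasure lborel (f -` A) = emeasure lborel A)"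
      and g: "det (matrix g) \<noteq> 0 \<longrightarrow>
        (\<forall>A\<in>sets borel. ennreal \<bar>det (matrix g)\<bar> * emeasure lborel (g -` A) = emeasure lborel A)"
    have det: "det (matrix (f \<circ> g)) = det (matrix f) * det (matrix g)"
      using lin by (simp add: matrix_compose det_mul)
    have "f -` A \<in> sets borel" if "A \<in> sets borel" for A
      using lin(1) that by (metis borel_measurable_continuous_onI linear_continuous_on linear_linear measurable_sets_borel)
    then show "det (matrix (f \<circ> g)) \<noteq> 0 \<longrightarrow>
        (\<forall>A\<in>sets borel. ennreal \<bar>det (matrix (f \<circ> g))\<bar> * emeasure lborel ((f \<circ> g) -` A) = emeasure lborel A)"
      using f g by (simp add: det abs_mult ennreal_mult mult.assoc vimage_comp[symmetric])
  next
    fix f :: "real^'n \<Rightarrow> real^'n" and i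
    assume "linear f" and 0: "\<And>x. f x $ i = 0"
    then have "row i (matrix f) = 0"
      by (simp add: row_def matrix_def vec_eq_iff)
    then show "det (matrix f) \<noteq> 0 \<longrightarrow>
      (\<forall>A\<in>sets borel. ennreal \<bar>det (matrix f)\<bar> * emeasure lborel (f -` A) = emeasure lborel A)"
      by (simp add: det_zero_row)
  next
    fix c :: "'n \<Rightarrow> real"
    let ?f = "\<lambda>x::real^'n. \<chi> i. c i * x $ i"
    have det: "det (matrix ?f) = prod c UNIV"
      by (subst det_diagonal) (auto simp: matrix_def axis_def)
    show "det (matrix ?f) \<noteq> 0 \<longrightarrow>
      (\<forall>A\<in>sets borel. ennreal \<bar>det (matrix ?f)\<bar> * emeasure lborel (?f -` A) = emeasure lborel A)"
    proof (intro impI ballI)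
      fix A :: "(real^'n) set"
      assume "det (matrix ?f) \<noteq> 0" and A: "A \<in> sets borel"
      then have c: "c i \<noteq> 0" for i
        by (simp add: det)
      \<comment> \<open>\<open>lborel_affine_euclidean\<close> takes coefficients indexed by basis
        vectors; this functional sends \<open>axis i 1\<close> to \<open>c i\<close>.\<close>
      let ?c = "\<lambda>b::real^'n. \<Sum>i\<in>UNIV. c i * b $ i"
      have c_axis: "?c (axis i 1) = c i" for i
        by (simp add: axis_def if_distrib cong: if_cong)
      have f_eq: "(\<Sum>j\<in>Basis. (?c j * (x \<bullet> j)) *\<^sub>R j) = ?f x" for x
        unfolding sum.reindex_bij_betw[OF bij_betw_axis_Basis, symmetric] c_axis inner_axis
        by (simp add: vec_eq_iff sum_component axis_def if_distrib cong: if_cong)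
      show "ennreal \<bar>det (matrix ?f)\<bar> * emeasure lborel (?f -` A) = emeasure lborel A"
      proof -
        have c0: "?c j \<noteq> 0" if "j \<in> Basis" for j :: "real^'n"
          using that c c_axis by (force simp: Basis_vec_def)
        have prod_c: "(\<Prod>j\<in>Basis. \<bar>?c j\<bar>) = \<bar>prod c UNIV\<bar>"
          by (simp only: prod.reindex_bij_betw[OF bij_betw_axis_Basis, symmetric] c_axis abs_prod)
        have eq: "(lborel :: (real^'n) measure) = density (distr lborel borel ?f) (\<lambda>_. ennreal \<bar>prod c UNIV\<bar>)"
          using lborel_affine_euclidean[of ?c 0, OF c0] unfolding f_eq prod_c by simp
        have "linear ?f"
          by (auto simp: linear_iff vec_eq_iff algebra_simps)
        then have [measurable]: "?f \<in> borel_measurable borel"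
          by (auto intro!: borel_measurable_continuous_onI linear_continuous_on simp: linear_linear)
        show ?thesis
          by (subst (2) eq) (use A in \<open>simp add: det emeasure_density nn_integral_cmult emeasure_distr\<close>)
      qed
    qed
  next
    fix m n :: 'n
    assume "m \<noteq> n"
    show "det (matrix (\<lambda>x::real^'n. \<chi> i. x $ Transposition.transpose m n i)) \<noteq> 0 \<longrightarrow>
      (\<forall>A\<in>sets borel. ennreal \<bar>det (matrix (\<lambda>x::real^'n. \<chi> i. x $ Transposition.transpose m n i))\<bar> * 
         emeasure lborel ((\<lambda>x::real^'n. \<chi> i. x $ Transposition.transpose m n i) -` A) = emeasure lborel A)"
      by (intro impI ballI) (simp add: det_matrix_swap emeasure_lborel_swap_vimage)
  next
    fix m n :: 'n
    assume "m \<noteq> n"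
    then show "det (matrix (\<lambda>x::real^'n. \<chi> i. if i = m then x $ m + x $ n else x $ i)) \<noteq> 0 \<longrightarrow>
      (\<forall>A\<in>sets borel. ennreal \<bar>det (matrix (\<lambda>x::real^'n. \<chi> i. if i = m then x $ m + x $ n else x $ i))\<bar> * 
         emeasure lborel ((\<lambda>x::real^'n. \<chi> i. if i = m then x $ m + x $ n else x $ i) -` A) = emeasure lborel A)"
      by (intro impI ballI) (simp add: det_matrix_shear emeasure_lborel_shear_vimage)
  qed
  with assms show ?thesis by blast
qed

text \<open>Rewriting \<open>lborel\<close> as a rescaled image measure gives the formula for every
  Borel \<open>h\<close>: when \<open>h\<close> is not integrable, both integrals are 0 by
  convention.\<close>

lemma integral_lborel_linear:
  fixes f :: "real^'n \<Rightarrow> real^'n" and h :: "real^'n \<Rightarrow> real"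
  assumes "linear f" "det (matrix f) \<noteq> 0" and [measurable]: "h \<in> borel_measurable borel"
  shows "\<bar>det (matrix f)\<bar> * (LINT x|lborel. h (f x)) = (LINT x|lborel. h x)"
    and "integrable lborel (\<lambda>x. h (f x)) \<longleftrightarrow> integrable lborel h"
proof -
  have [measurable]: "f \<in> borel_measurable borel"
    using \<open>linear f\<close> by (metis borel_measurable_continuous_onI linear_continuous_on linear_linear)
  have "lborel = density (distr lborel borel f) (\<lambda>_. ennreal \<bar>det (matrix f)\<bar>)"
    using emeasure_lborel_linear_vimage[OF assms(1,2)]
    by (intro measure_eqI) (auto simp: emeasure_density emeasure_distr nn_integral_cmult)
  note eq = this
  show "\<bar>det (matrix f)\<bar> * (LINT x|lborel. h (f x)) = (LINT x|lborel. h x)"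
    by (subst (2) eq) (simp add: integral_density integral_distr)
  show "integrable lborel (\<lambda>x. h (f x)) \<longleftrightarrow> integrable lborel h"
    using assms(2) by (subst (2) eq) (simp add: integrable_density integrable_distr_eq)
qed

subsection \<open>Positive definite forms and radial integrability\<close>

lemma inner_matrix_vector_sym:
  fixes A :: "real^'n^'n"
  assumes "transpose A = A"
  shows "x \<bullet> (A *v y) = y \<bullet> (A *v x)"
  by (metis assms dot_lmul_matrix inner_commute vector_transpose_matrix)

text \<open>Gram-Schmidt for the inner product given by \<open>A\<close>.\<close>

lemma pos_def_orthonormal_matrix:
  fixes A :: "real^'n^'n"
  assumes "pos_def A"
  obtains T :: "real^'n^'n" where "transpose T ** A ** T = mat 1"
proof -
  have sym: "x \<bullet> (A *v y) = y \<bullet> (A *v x)" for x y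
    using assms by (intro inner_matrix_vector_sym) (simp add: pos_def_def)
  have pos: "x \<bullet> (A *v x) > 0" if "x \<noteq> 0" for x
    using assms that by (simp add: pos_def_def)
  define ortho where "ortho B \<longleftrightarrow> finite B \<and> (\<forall>x\<in>B. \<forall>y\<in>B. x \<bullet> (A *v y) = (if x = y then 1 else 0))" for B
  have indep: "independent B" if "ortho B" for B
    unfolding independent_explicit
  proof (intro conjI allI impI ballI)
    show "finite B" using that by (simp add: ortho_def)
    fix u v assume u: "(\<Sum>v\<in>B. u v *\<^sub>R v) = 0" and "v \<in> B"
    have "0 = v \<bullet> (A *v (\<Sum>w\<in>B. u w *\<^sub>R w))"
      by (simp add: u)
    also have "\<dots> = (\<Sum>w\<in>B. u w * (v \<bullet> (A *v w)))"
      by (simp add: linear_sum[OF matrix_vector_mul_linear] inner_sum_right linear_cmul[OF matrix_vector_mul_linear])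
    also have "\<dots> = (\<Sum>w\<in>B. if v = w then u w else 0)"
      using that \<open>v \<in> B\<close> by (intro sum.cong) (auto simp: ortho_def)
    also have "\<dots> = u v"
      using \<open>v \<in> B\<close> \<open>finite B\<close> by simp
    finally show "u v = 0" by simp
  qed
  have step: "\<exists>B'. ortho B' \<and> card B' = Suc (card B)" if B: "ortho B" and less: "card B < CARD('n)" for B
  proof -
    have fin: "finite B" using B by (simp add: ortho_def)
    have "span B \<noteq> UNIV"
      using less indep[OF B] dim_eq_card[of B UNIV] by (auto simp: dim_UNIV)
    then obtain x where x: "x \<notin> span B" by blast
    define z where "z = x - (\<Sum>b\<in>B. (x \<bullet> (A *v b)) *\<^sub>R b)"
    have "x - z \<in> span B"
      unfolding z_def by (simp add: span_sum span_scale span_base)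
    then have z_span: "z \<notin> span B"
      using x span_add[of "x - z" B z] by auto
    then have "z \<noteq> 0"
      using span_zero by auto
    have zb: "z \<bullet> (A *v b) = 0" if "b \<in> B" for b
    proof -
      have "(\<Sum>a\<in>B. (x \<bullet> (A *v a)) * (a \<bullet> (A *v b))) = (\<Sum>a\<in>B. if a = b then x \<bullet> (A *v b) else 0)"
        using B that by (intro sum.cong) (auto simp: ortho_def)
      then show ?thesis
        using that fin by (simp add: z_def inner_diff_left inner_sum_left)
    qed
    have bz: "b \<bullet> (A *v z) = 0" if "b \<in> B" for b
      using zb[OF that] by (simp add: sym[of b z])
    define c where "c = 1 / sqrt (z \<bullet> (A *v z))"
    have c2: "c * (c * (z \<bullet> (A *v z))) = 1"
      using pos[OF \<open>z \<noteq> 0\<close>] by (simp add: c_def)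
    have "c *\<^sub>R z \<notin> span B"
      using z_span pos[OF \<open>z \<noteq> 0\<close>] span_scale[of "c *\<^sub>R z" B "1 / c"] by (auto simp: c_def)
    then have "c *\<^sub>R z \<notin> B"
      using span_base by blast
    moreover have "ortho (insert (c *\<^sub>R z) B)"
      using B fin c2 \<open>c *\<^sub>R z \<notin> B\<close>
      by (auto simp: ortho_def matrix_vector_mult_scaleR zb bz)
    ultimately show ?thesis
      using fin by (intro exI[of _ "insert (c *\<^sub>R z) B"]) auto
  qed
  have "\<exists>B. ortho B \<and> card B = k" if "k \<le> CARD('n)" for k
    using that
  proof (induction k)
    case 0 show ?case by (intro exI[of _ "{}"]) (simp add: ortho_def)
  next
    case (Suc k) then show ?case using step by (metis Suc_leD Suc_le_lessD)
  qed
  then obtain B where B: "ortho B" "card B = CARD('n)" by blast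
  then obtain e where e: "bij_betw e (UNIV :: 'n set) B"
    by (metis finite_same_card_bij finite ortho_def)
  define T where "T = (\<chi> i j. e j $ i)"
  have T_axis: "T *v axis j 1 = e j" for j
    by (simp add: T_def matrix_vector_mult_basis column_def vec_eq_iff)
  have "(transpose T ** A ** T) $ i $ j = axis i 1 \<bullet> (transpose T ** A ** T *v axis j 1)" for i j
    by (simp add: matrix_vector_mult_basis column_def inner_axis')
  also have "axis i 1 \<bullet> (transpose T ** A ** T *v axis j 1) = axis i 1 \<bullet> (transpose T *v (A *v e j))" for i j
    by (simp only: matrix_vector_mul_assoc[symmetric] T_axis)
  also have "axis i 1 \<bullet> (transpose T *v (A *v e j)) = e i \<bullet> (A *v e j)" for i j
    by (metis T_axis dot_lmul_matrix inner_commute transpose_matrix_vector)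
  also have "e i \<bullet> (A *v e j) = mat 1 $ i $ j" for i j
    using B e by (auto simp: ortho_def mat_def bij_betw_def inj_on_eq_iff)
  finally have "transpose T ** A ** T = mat 1"
    by (simp add: vec_eq_iff)
  then show thesis by (rule that)
qed

text \<open>The integrand is dominated by a geometric series of multiples of indicators of dyadic balls.\<close>

lemma integrable_one_plus_norm_powr:
  fixes a \<nu> :: real
  assumes "0 < \<nu>" "real DIM('a::euclidean_space) < 2 * a"
  shows "integrable lborel (\<lambda>x::'a. (1 + (norm x)\<^sup>2 / \<nu>) powr (- a))"
proof -
  let ?f = "\<lambda>x::'a. (1 + (norm x)\<^sup>2 / \<nu>) powr (- a)"
  define d where "d = real DIM('a)"
  \<comment> \<open>Ratio of consecutive terms of the series: doubling the radius multiplies the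
    volume by \<open>2 powr d\<close>, while the bound on the integrand falls by
    \<open>2 powr (2 * a)\<close>. The hypothesis on \<open>a\<close> says exactly that
    \<open>r < 1\<close>.\<close>
  define r where "r = 2 powr (d - 2 * a)"
  \<comment> \<open>The product of \<open>max 1 \<nu>\<close> and the base of the power is at least
    1 and at least the squared norm. So it dominates the square of \<open>2 ^ k\<close> on the k-th
    dyadic shell, also for k = 0, where the norm has no lower bound.\<close>
  define C where "C = max 1 \<nu> powr a"
  define V where "V = measure lborel (ball (0::'a) 1)"
  define g where "g k x = ennreal (C * 2 powr (- 2 * a * real k)) * indicator (ball (0::'a) (2 ^ Suc k)) x" for k :: nat and x
  have g_measurable: "(\<lambda>x. g k x) \<in> borel_measurable lborel" for k
    unfolding g_def
    by (intro borel_measurable_times_ennreal borel_measurable_const borel_measurable_indicator) simp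
  have a: "a > 0" using assms by auto
  have bound: "ennreal (?f x) \<le> (\<Sum>k. g k x)" for x
  proof -
    obtain n where "norm x < 2 ^ n"
      using real_arch_pow[of 2 "norm x"] by auto
    also have "(2::real) ^ n \<le> 2 ^ Suc n" by simp
    finally have ex: "norm x < 2 ^ Suc n" .
    define k where "k = (LEAST k. norm x < 2 ^ Suc k)"
    have less: "norm x < 2 ^ Suc k"
      unfolding k_def by (rule LeastI[of "\<lambda>k. norm x < 2 ^ Suc k", OF ex])
    have ge: "2 ^ k \<le> norm x" if "k \<noteq> 0"
      using not_less_Least[of "k - 1" "\<lambda>k. norm x < 2 ^ Suc k"] that unfolding k_def[symmetric] by simp
    have "(2 ^ k)\<^sup>2 \<le> max 1 \<nu> * (1 + (norm x)\<^sup>2 / \<nu>)"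
    proof (cases "k = 0")
      case True
      have "1 * 1 \<le> max 1 \<nu> * (1 + (norm x)\<^sup>2 / \<nu>)"
        using assms by (intro mult_mono) auto
      then show ?thesis using True by simp
    next
      case False
      then have "(2 ^ k)\<^sup>2 \<le> (norm x)\<^sup>2"
        using ge by (intro power_mono) auto
      also have "\<dots> = \<nu> * ((norm x)\<^sup>2 / \<nu>)"
        using assms by simp
      also have "\<dots> \<le> max 1 \<nu> * (1 + (norm x)\<^sup>2 / \<nu>)"
        using assms by (intro mult_mono) auto
      finally show ?thesis .
    qed
    then have "((2 ^ k)\<^sup>2) powr a \<le> (max 1 \<nu> * (1 + (norm x)\<^sup>2 / \<nu>)) powr a"
      using a by (intro powr_mono2) auto
    also have "((2 ^ k)\<^sup>2) powr a = 2 powr (2 * a * real k)"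
    proof -
      have "((2::real) ^ k)\<^sup>2 = 2 powr real (k * 2)"
        by (subst powr_realpow) (simp_all add: power_mult)
      then show ?thesis by (simp add: powr_powr mult_ac)
    qed
    also have "(max 1 \<nu> * (1 + (norm x)\<^sup>2 / \<nu>)) powr a = C * (1 + (norm x)\<^sup>2 / \<nu>) powr a"
      using assms by (simp add: C_def powr_mult)
    finally have "2 powr (2 * a * real k) \<le> C * (1 + (norm x)\<^sup>2 / \<nu>) powr a" .
    have "1 + (norm x)\<^sup>2 / \<nu> > 0"
      using assms by (intro add_pos_nonneg) auto
    have "1 / (1 + (norm x)\<^sup>2 / \<nu>) powr a \<le> C * (1 / 2 powr (2 * a * real k))"
    proof -
      have "1 / P \<le> C * (1 / Q)" if "Q \<le> C * P" "0 < P" "0 < Q" for P Q :: real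
        using that by (simp add: field_simps)
      then show ?thesis
        using \<open>2 powr (2 * a * real k) \<le> _\<close> \<open>1 + (norm x)\<^sup>2 / \<nu> > 0\<close> by simp
    qed
    then have "?f x \<le> C * 2 powr (- 2 * a * real k)"
      by (simp add: powr_minus_divide)
    then have "ennreal (?f x) \<le> g k x"
      using less by (simp add: g_def ennreal_leI)
    also have "g k x \<le> (\<Sum>k. g k x)"
      using sum_le_suminf[of "\<lambda>k. g k x" "{k}"] by simp
    finally show ?thesis .
  qed
  have "(\<integral>\<^sup>+x. ennreal (?f x) \<partial>lborel) \<le> (\<integral>\<^sup>+x. (\<Sum>k. g k x) \<partial>lborel)"
    by (rule nn_integral_mono) (rule bound)
  also have "\<dots> = (\<Sum>k. \<integral>\<^sup>+x. g k x \<partial>lborel)"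
    by (rule nn_integral_suminf[OF g_measurable])
  also have "\<dots> = (\<Sum>k. ennreal (C * 2 powr d * V * r ^ k))"
  proof (intro suminf_cong)
    fix k :: nat
    have "emeasure lborel (ball (0::'a) (2 ^ Suc k)) = ennreal ((2 ^ Suc k) ^ DIM('a) * V)"
      using emeasure_lborel_ball_finite[of "0::'a" "2 ^ Suc k"] content_ball_conv_unit_ball[of "2 ^ Suc k" "0::'a"]
      by (subst emeasure_eq_ennreal_measure) (simp_all add: V_def)
    then have "(\<integral>\<^sup>+x. g k x \<partial>lborel) = ennreal (C * 2 powr (- 2 * a * real k)) * ennreal ((2 ^ Suc k) ^ DIM('a) * V)"
      unfolding g_def by (subst nn_integral_cmult_indicator) auto
    also have "((2::real) ^ Suc k) ^ DIM('a) = 2 powr (real (Suc k * DIM('a)))"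
      unfolding power_mult[symmetric] by (rule powr_realpow[symmetric]) simp
    also have "real (Suc k * DIM('a)) = d * real k + d"
      by (simp add: d_def algebra_simps)
    also have "ennreal (C * 2 powr (- 2 * a * real k)) * ennreal (2 powr (d * real k + d) * V)
        = ennreal ((C * 2 powr (- 2 * a * real k)) * (2 powr (d * real k + d) * V))"
      by (rule ennreal_mult[symmetric]) (simp_all add: C_def V_def)
    also have "(C * 2 powr (- 2 * a * real k)) * (2 powr (d * real k + d) * V)
        = C * 2 powr d * V * (2 powr (- 2 * a * real k) * 2 powr (d * real k))"
      by (simp add: powr_add)
    also have "2 powr (- 2 * a * real k) * 2 powr (d * real k) = r ^ k"
      by (simp add: r_def powr_power powr_add[symmetric] algebra_simps)
    finally show "(\<integral>\<^sup>+x. g k x \<partial>lborel) = ennreal (C * 2 powr d * V * r ^ k)" .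
  qed
  also have "\<dots> < \<infinity>"
  proof -
    have "0 \<le> r" "r < 1" using assms by (auto simp: r_def d_def powr_less_one)
    then have "summable (\<lambda>k. C * 2 powr d * V * r ^ k)"
      by (intro summable_mult summable_geometric) simp
    then show ?thesis
      using \<open>0 \<le> r\<close> by (subst suminf_ennreal2) (auto simp: C_def V_def)
  qed
  finally show ?thesis
    by (intro integrableI_bounded) auto
qed

subsection \<open>Differentiability in the parameter\<close>

lemma has_derivative_eventually_nhds:
  assumes "(f has_derivative D) (at x)" "\<forall>\<^sub>F y in nhds x. f y = g y"
  shows "(g has_derivative D) (at x)"
  using assms by (auto simp: eventually_nhds_conv_at intro: has_derivative_transform_eventually)

lemma transpose_scale_matrix: "transpose (scale_matrix \<eta>) = scale_matrix \<eta>"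
proof -
  have "Upair i j = Upair j i" for i j :: 'a by simp
  then show ?thesis by (auto simp: transpose_def scale_matrix_def vec_eq_iff intro: arg_cong)
qed

lemma bounded_linear_location: "bounded_linear location"
  unfolding linear_conv_bounded_linear[symmetric]
  by (auto simp: linear_iff location_def vec_eq_iff)

lemma bounded_linear_scale_matrix: "bounded_linear scale_matrix"
  unfolding linear_conv_bounded_linear[symmetric]
  by (auto simp: linear_iff scale_matrix_def vec_eq_iff)

section \<open>Derivative of the determinant\<close>

lemma det_has_derivative:
  fixes A :: "real^'n^'n"
  shows "(det has_derivative (\<lambda>H. \<Sum>p | p permutes (UNIV :: 'n set).
            of_int (sign p) * (\<Sum>i\<in>UNIV. H $ i $ p i * (\<Prod>j\<in>UNIV - {i}. A $ j $ p j)))) (at A)"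
proof -
  have entry: "((\<lambda>X. X $ i $ j) has_derivative (\<lambda>H. H $ i $ j)) (at A)" for i j
    by (intro linear_imp_has_derivative) (simp add: linear_iff)
  show ?thesis
    unfolding det_def[abs_def]
    by (rule has_derivative_sum, rule has_derivative_mult_right, rule has_derivative_prod, rule entry)
qed

text \<open>A permutation other than the identity moves at least two points, so deleting one factor
  still leaves an off-diagonal entry of the identity matrix.\<close>

lemma det_has_derivative_mat_1: "(det has_derivative trace) (at (mat 1 :: real^'n^'n))"
proof -
  have "(\<Sum>p | p permutes (UNIV :: 'n set). of_int (sign p) *
          (\<Sum>i\<in>UNIV. H $ i $ p i * (\<Prod>j\<in>UNIV - {i}. (mat 1 :: real^'n^'n) $ j $ p j))) = trace H" for H :: "real^'n^'n"
  proof -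
    have zero: "(\<Prod>j\<in>UNIV - {i}. (mat 1 :: real^'n^'n) $ j $ p j) = 0"
      if p: "p permutes (UNIV :: 'n set)" and "p \<noteq> id" for p i
    proof -
      have "\<exists>j. j \<noteq> i \<and> p j \<noteq> j"
      proof (rule ccontr)
        assume "\<not> ?thesis"
        then have fix_others: "p j = j" if "j \<noteq> i" for j using that by blast
        then have "p i = i" by (metis p permutes_inj injD)
        with fix_others have "p j = j" for j by (cases "j = i") auto
        then have "p = id" by (simp add: fun_eq_iff)
        with \<open>p \<noteq> id\<close> show False by simp
      qed
      then obtain j where "j \<noteq> i" "p j \<noteq> j" by blast
      then show ?thesis
        by (intro prod_zero) (auto simp: mat_def intro!: bexI[of _ j])
    qed
    have "(\<Sum>p | p permutes (UNIV :: 'n set). of_int (sign p) *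
          (\<Sum>i\<in>UNIV. H $ i $ p i * (\<Prod>j\<in>UNIV - {i}. (mat 1 :: real^'n^'n) $ j $ p j)))
       = (\<Sum>p | p permutes (UNIV :: 'n set). if p = id then trace H else 0)"
    proof (intro sum.cong refl)
      fix p assume "p \<in> {p. p permutes (UNIV :: 'n set)}"
      then show "of_int (sign p) * (\<Sum>i\<in>UNIV. H $ i $ p i * (\<Prod>j\<in>UNIV - {i}. (mat 1 :: real^'n^'n) $ j $ p j))
          = (if p = id then trace H else 0)"
        by (cases "p = id") (simp_all add: zero, simp add: trace_def mat_def)
    qed
    also have "\<dots> = trace H"
      by (simp add: permutes_id)
    finally show ?thesis .
  qed
  then show ?thesis
    using det_has_derivative[of "mat 1 :: real^'n^'n"] by simp
qed

lemma det_differentiable: "det differentiable (at (A :: real^'n^'n))"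
  using det_has_derivative unfolding differentiable_def by blast

text \<open>Jacobi's formula. Multiplying by the inverse moves the base point to the identity
  matrix, where the derivative is the trace; \<open>det X = det A * det (B ** X)\<close> carries the
  result back.\<close>

lemma det_has_derivative_invertible:
  fixes A B :: "real^'n^'n"
  assumes "A ** B = mat 1"
  shows "(det has_derivative (\<lambda>H. det A * trace (B ** H))) (at A)"
proof -
  have BA: "B ** A = mat 1"
    using assms by (simp add: matrix_left_right_inverse)
  have bl: "bounded_linear (\<lambda>X::real^'n^'n. B ** X)"
    unfolding linear_conv_bounded_linear[symmetric]
    by (simp add: linear_iff matrix_add_ldistrib matrix_matrix_mult_def vec_eq_iff sum_distrib_left algebra_simps sum.distrib)
  have "((\<lambda>X. det (B ** X)) has_derivative (\<lambda>H. trace (B ** H))) (at A)"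
    by (rule has_derivative_compose[OF bounded_linear_imp_has_derivative[OF bl]])
      (simp add: BA det_has_derivative_mat_1)
  then have "((\<lambda>X. det A * det (B ** X)) has_derivative (\<lambda>H. det A * trace (B ** H))) (at A)"
    by (rule has_derivative_mult_right)
  moreover have "det A * det (B ** X) = det X" for X
    using assms by (metis det_I det_mul mult.assoc mult_1)
  ultimately show ?thesis by simp
qed

section \<open>Positive definite matrices and their stability\<close>

lemma pos_def_invertible: 
  assumes "pos_def (A :: real^'n^'n)"
  shows "A ** matrix_inv A = mat 1" "matrix_inv A ** A = mat 1" "det A \<noteq> 0"
proof -
  have "x = 0" if "A *v x = 0" for x
    using assms that unfolding pos_def_def by (metis inner_zero_right less_irrefl)
  then have "invertible A"
    by (simp add: invertible_left_inverse matrix_left_invertible_ker)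
  then have "A ** matrix_inv A = mat 1 \<and> matrix_inv A ** A = mat 1"
    unfolding invertible_def matrix_inv_def by (rule someI_ex)
  with \<open>invertible A\<close> show "A ** matrix_inv A = mat 1" "matrix_inv A ** A = mat 1" "det A \<noteq> 0"
    by (simp_all add: invertible_det_nz)
qed

text \<open>Compactness of the unit sphere turns pointwise positivity into a uniform margin, which
  absorbs the perturbation in \<open>eventually_pos_def_scale_matrix\<close>.\<close>

lemma pos_def_coercive:
  assumes "pos_def (A :: real^'n^'n)"
  obtains c where "c > 0" "\<And>x. c * (norm x)\<^sup>2 \<le> x \<bullet> (A *v x)"
proof -
  have "continuous_on (sphere 0 1) (\<lambda>x. x \<bullet> (A *v x))"
    by (intro continuous_intros linear_continuous_on) (simp add: linear_linear[symmetric])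
  moreover have "sphere 0 1 \<noteq> ({} :: (real^'n) set)"
    by simp
  ultimately obtain u where u: "norm u = 1" "\<And>x. norm x = 1 \<Longrightarrow> u \<bullet> (A *v u) \<le> x \<bullet> (A *v x)"
    using continuous_attains_inf[of "sphere 0 1" "\<lambda>x. x \<bullet> (A *v x)"] by (auto simp: compact_sphere)
  show thesis
  proof (rule that)
    show "u \<bullet> (A *v u) > 0"
      using assms u(1) unfolding pos_def_def by (metis norm_zero zero_neq_one)
    show "(u \<bullet> (A *v u)) * (norm x)\<^sup>2 \<le> x \<bullet> (A *v x)" for x
    proof (cases "x = 0")
      case False
      then have "u \<bullet> (A *v u) \<le> (x /\<^sub>R norm x) \<bullet> (A *v (x /\<^sub>R norm x))"
        by (intro u(2)) simp
      also have "\<dots> = (x \<bullet> (A *v x)) / (norm x)\<^sup>2"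
        by (simp add: linear_cmul[OF matrix_vector_mul_linear] power2_eq_square divide_inverse)
      finally show ?thesis
        using False by (simp add: field_simps)
    qed simp
  qed
qed

text \<open>A derivative at \<eta> sees a whole neighbourhood, whereas the formulas for the inverse
  and for the normalizing constant hold at positive definite scale matrices. Openness of that
  condition reconciles the two.\<close>

lemma eventually_pos_def_scale_matrix:
  fixes \<eta> :: "('n::finite) param"
  assumes "pos_def (scale_matrix \<eta>)"
  shows "\<forall>\<^sub>F \<eta>' in nhds \<eta>. pos_def (scale_matrix \<eta>')"
proof -
  obtain c where c: "c > 0" "\<And>x. c * (norm x)\<^sup>2 \<le> x \<bullet> (scale_matrix \<eta> *v x)"
    using pos_def_coercive[OF assms] by blast
  \<comment> \<open>The entrywise sum bounds the operator norm of the perturbation and is visibly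
    continuous in the parameter.\<close>
  define e where "e \<eta>' = (\<Sum>i\<in>UNIV. \<Sum>j\<in>UNIV. \<bar>(scale_matrix \<eta>' - scale_matrix \<eta>) $ i $ j\<bar>)" for \<eta>' :: "'n param"
  have "continuous (at \<eta>) e"
    unfolding e_def[abs_def]
    by (intro continuous_intros bounded_linear.continuous[OF bounded_linear_scale_matrix])
  then have "(e \<longlongrightarrow> e \<eta>) (nhds \<eta>)"
    unfolding isCont_def tendsto_at_iff_tendsto_nhds .
  then have "(e \<longlongrightarrow> 0) (nhds \<eta>)"
    by (simp add: e_def)
  then have "\<forall>\<^sub>F \<eta>' in nhds \<eta>. e \<eta>' < c"
    using c(1) by (rule order_tendstoD)
  then show ?thesis
  proof (rule eventually_mono)
    fix \<eta>' assume less: "e \<eta>' < c"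
    let ?D = "scale_matrix \<eta>' - scale_matrix \<eta>"
    have "x \<bullet> (scale_matrix \<eta>' *v x) > 0" if "x \<noteq> 0" for x
    proof -
      have "norm (?D *v x) \<le> e \<eta>' * norm x"
        unfolding e_def using onorm[OF matrix_vector_mul_bounded_linear, of ?D x] onorm_le_matrix_component_sum[of ?D]
        by (meson mult_right_mono norm_ge_zero order_trans)
      then have "norm x * norm (?D *v x) \<le> norm x * (e \<eta>' * norm x)"
        by (intro mult_left_mono) auto
      then have "\<bar>x \<bullet> (?D *v x)\<bar> \<le> e \<eta>' * (norm x)\<^sup>2"
        using Cauchy_Schwarz_ineq2[of x "?D *v x"] by (simp add: power2_eq_square mult_ac)
      moreover have "e \<eta>' * (norm x)\<^sup>2 < c * (norm x)\<^sup>2"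
        using less that by simp
      moreover have "x \<bullet> (scale_matrix \<eta>' *v x) = x \<bullet> (scale_matrix \<eta> *v x) + x \<bullet> (?D *v x)"
        by (simp add: matrix_vector_mult_diff_rdistrib inner_diff_right)
      ultimately show ?thesis
        using c(2)[of x] by linarith
    qed
    then show "pos_def (scale_matrix \<eta>')"
      by (simp add: pos_def_def transpose_scale_matrix)
  qed
qed

text \<open>By Cramer's rule the solution is a quotient of polynomials in the parameter.\<close>

lemma scale_matrix_solve_differentiable:
  fixes \<eta> :: "('n::finite) param"
  assumes "pos_def (scale_matrix \<eta>)"
  shows "(\<lambda>\<eta>'. matrix_inv (scale_matrix \<eta>') *v (x - location \<eta>')) differentiable (at \<eta>)"
proof -
  have loc: "location differentiable at \<eta>" and scale: "scale_matrix differentiable at \<eta>"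
    using bounded_linear_location bounded_linear_scale_matrix bounded_linear_imp_differentiable by blast+
  define R where "R k \<eta>' = (\<chi> i j. if j = k then (x - location \<eta>') $ i else scale_matrix \<eta>' $ i $ j)"
    for k and \<eta>' :: "'n param"
  define y where "y \<eta>' = (\<chi> k. det (R k \<eta>') / det (scale_matrix \<eta>'))" for \<eta>' :: "'n param"
  have "(\<lambda>\<eta>'. R k \<eta>') differentiable at \<eta>" for k
  proof -
    \<comment> \<open>The matrix in Cramer's rule is only affine in the parameter, because
      \<open>x\<close> occurs in column \<open>k\<close>; subtracting its value at 0 makes it
      linear.\<close>
    have "linear (\<lambda>\<eta>'. R k \<eta>' - R k 0)"
      by (auto simp: linear_iff R_def vec_eq_iff location_def scale_matrix_def algebra_simps)
    then have "(\<lambda>\<eta>'. (R k \<eta>' - R k 0) + R k 0) differentiable at \<eta>"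
      by (rule differentiable_add[OF linear_imp_differentiable differentiable_const])
    then show ?thesis by simp
  qed
  then have "(\<lambda>\<eta>'. det (R k \<eta>')) differentiable at \<eta>" for k
    by (rule differentiable_compose[OF det_differentiable])
  moreover have "(\<lambda>\<eta>'. det (scale_matrix \<eta>')) differentiable at \<eta>"
    by (rule differentiable_compose[OF det_differentiable scale])
  ultimately have "(\<lambda>\<eta>'. y \<eta>' $ k) differentiable at \<eta>" for k
    unfolding y_def vec_lambda_beta
    by (rule differentiable_divide) (rule pos_def_invertible(3)[OF assms])
  then have "\<forall>b\<in>Basis. (\<lambda>\<eta>'. y \<eta>' \<bullet> b) differentiable at \<eta>"
    by (auto simp: Basis_vec_def inner_axis)
  then have "y differentiable at \<eta>"
    by (rule differentiable_componentwise_within[THEN iffD2])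
  then obtain D where "(y has_derivative D) (at \<eta>)"
    by (auto simp: differentiable_def)
  moreover have "\<forall>\<^sub>F \<eta>' in nhds \<eta>. y \<eta>' = matrix_inv (scale_matrix \<eta>') *v (x - location \<eta>')"
    using eventually_pos_def_scale_matrix[OF assms]
  proof (rule eventually_mono)
    fix \<eta>' :: "'n param"
    assume "pos_def (scale_matrix \<eta>')"
    note inv = pos_def_invertible[OF this]
    have "scale_matrix \<eta>' *v (matrix_inv (scale_matrix \<eta>') *v (x - location \<eta>')) = x - location \<eta>'"
      by (simp add: matrix_vector_mul_assoc inv)
    from cramer[OF inv(3), THEN iffD1, OF this]
    show "y \<eta>' = matrix_inv (scale_matrix \<eta>') *v (x - location \<eta>')"
      unfolding y_def R_def by (rule sym)
  qed
  ultimately have "((\<lambda>\<eta>'. matrix_inv (scale_matrix \<eta>') *v (x - location \<eta>')) has_derivative D) (at \<eta>)"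
    by (rule has_derivative_eventually_nhds)
  then show ?thesis
    by (auto simp: differentiable_def)
qed

text \<open>Differentiating \<open>\<Sigma> y = x - \<mu>\<close> implicitly avoids computing the
  derivative of the inverse matrix.\<close>

lemma mahalanobis_has_derivative:
  fixes \<eta> :: "('n::finite) param" and x :: "real^'n"
  assumes pd: "pos_def (scale_matrix \<eta>)"
  defines "y \<equiv> matrix_inv (scale_matrix \<eta>) *v (x - location \<eta>)"
  shows "((\<lambda>\<eta>'. (x - location \<eta>') \<bullet> (matrix_inv (scale_matrix \<eta>') *v (x - location \<eta>'))) has_derivative
           (\<lambda>h. - 2 * (location h \<bullet> y) - y \<bullet> (scale_matrix h *v y))) (at \<eta>)"
proof -
  define Y where "Y \<eta>' = matrix_inv (scale_matrix \<eta>') *v (x - location \<eta>')" for \<eta>'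
  have Y_y: "Y \<eta> = y" by (simp add: Y_def y_def)
  obtain D where D: "(Y has_derivative D) (at \<eta>)"
    using scale_matrix_solve_differentiable[OF pd, of x] by (auto simp: differentiable_def Y_def[abs_def])
  have Yz: "scale_matrix \<eta>' *v Y \<eta>' = x - location \<eta>'" if "pos_def (scale_matrix \<eta>')" for \<eta>'
    by (simp add: Y_def matrix_vector_mul_assoc pos_def_invertible[OF that])
  have bb: "bounded_bilinear ((*v) :: real^'n^'n \<Rightarrow> _)"
    unfolding bilinear_conv_bounded_bilinear[symmetric] bilinear_def
    by (auto simp: linear_iff matrix_vector_mult_add_rdistrib matrix_vector_right_distrib
        matrix_vector_mult_scaleR scaleR_matrix_vector_assoc)
  have dz: "((\<lambda>\<eta>'. x - location \<eta>') has_derivative (\<lambda>h. - location h)) (at \<eta>)"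
    by (auto intro!: derivative_eq_intros bounded_linear_imp_has_derivative[OF bounded_linear_location])
  have ev: "\<forall>\<^sub>F \<eta>' in nhds \<eta>. x - location \<eta>' = scale_matrix \<eta>' *v Y \<eta>'"
    using eventually_pos_def_scale_matrix[OF pd] by eventually_elim (simp add: Yz)
  have "((\<lambda>\<eta>'. scale_matrix \<eta>' *v Y \<eta>') has_derivative (\<lambda>h. scale_matrix \<eta> *v D h + scale_matrix h *v Y \<eta>)) (at \<eta>)"
    by (rule bounded_bilinear.FDERIV[OF bb bounded_linear_imp_has_derivative[OF bounded_linear_scale_matrix] D])
  moreover have "((\<lambda>\<eta>'. scale_matrix \<eta>' *v Y \<eta>') has_derivative (\<lambda>h. - location h)) (at \<eta>)"
    by (rule has_derivative_eventually_nhds[OF dz ev])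
  ultimately have "(\<lambda>h. scale_matrix \<eta> *v D h + scale_matrix h *v Y \<eta>) = (\<lambda>h. - location h)"
    by (rule has_derivative_unique)
  then have "scale_matrix \<eta> *v D h + scale_matrix h *v y = - location h" for h
    by (simp add: fun_eq_iff Y_y)
  then have SD: "scale_matrix \<eta> *v D h = - location h - scale_matrix h *v y" for h
    by (simp add: eq_diff_eq)
  \<comment> \<open>Writing the deviation as the scale matrix times \<open>y\<close> and using
    symmetry leaves only \<open>scale_matrix \<eta> *v D h\<close>, which \<open>SD\<close>
    provides; \<open>D\<close> is never solved for.\<close>
  have zD: "(x - location \<eta>) \<bullet> D h = - (location h \<bullet> y) - y \<bullet> (scale_matrix h *v y)" for h
  proof -
    have "(x - location \<eta>) \<bullet> D h = D h \<bullet> (scale_matrix \<eta> *v y)"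
      by (simp add: Yz[OF pd, unfolded Y_y] inner_commute)
    also have "\<dots> = y \<bullet> (scale_matrix \<eta> *v D h)"
      by (rule inner_matrix_vector_sym) (rule transpose_scale_matrix)
    finally show ?thesis by (simp add: SD inner_diff_right inner_commute)
  qed
  have "((\<lambda>\<eta>'. (x - location \<eta>') \<bullet> Y \<eta>') has_derivative (\<lambda>h. (x - location \<eta>) \<bullet> D h + (- location h) \<bullet> Y \<eta>)) (at \<eta>)"
    by (rule has_derivative_inner[OF dz D])
  then show ?thesis
    by (simp add: zD Y_y Y_def[symmetric])
qed

subsection \<open>Second moments and the score equations\<close>

lemma scaleR_matrix_mult_left: "(k *\<^sub>R (A :: real^'n^'m)) ** (B :: real^'p^'n) = k *\<^sub>R (A ** B)"
  by (simp add: matrix_matrix_mult_def vec_eq_iff sum_distrib_left mult.assoc)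

lemma scaleR_matrix_mult_right: "(A :: real^'n^'m) ** (k *\<^sub>R (B :: real^'p^'n)) = k *\<^sub>R (A ** B)"
  by (simp add: matrix_matrix_mult_def vec_eq_iff sum_distrib_left mult.left_commute)

lemma trace_scaleR: "trace (k *\<^sub>R (A :: real^'n^'n)) = k * trace A"
  by (simp add: trace_def sum_distrib_left)

lemma location_axis_Inr [simp]: "location (axis (Inr u) 1) = 0"
  and scale_matrix_axis_Inl [simp]: "scale_matrix (axis (Inl i) 1) = 0"
  and location_axis_Inl [simp]: "location (axis (Inl i) 1) = axis i 1"
  by (auto simp: location_def scale_matrix_def vec_eq_iff axis_def)

text \<open>One scale coordinate moves the entries (i, j) and (j, i) together, hence the factor 2
  off the diagonal. The factor is never 0, so these directions still detect every entry of a
  symmetric matrix.\<close>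

lemma trace_scale_matrix_axis:
  fixes A :: "real^'n^'n"
  assumes "transpose A = A"
  shows "trace (scale_matrix (axis (Inr (Upair i j)) 1) ** A) = (if i = j then 1 else 2) * A $ i $ j"
proof -
  have sym: "A $ j $ i = A $ i $ j"
    using assms by (metis transpose_def vec_lambda_beta)
  have "trace (scale_matrix (axis (Inr (Upair i j)) 1) ** A)
      = (\<Sum>k\<in>UNIV. \<Sum>l\<in>UNIV. if Upair k l = Upair i j then A $ l $ k else 0)"
    by (simp add: trace_def matrix_matrix_mult_def scale_matrix_def axis_def if_distrib if_distribR eq_commute cong: if_cong)
  also have "\<dots> = (\<Sum>(k, l)\<in>{(i, j), (j, i)}. A $ l $ k)"
    unfolding sum.cartesian_product
    by (rule sum.mono_neutral_cong_right) (auto split: if_splits)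
  also have "\<dots> = (if i = j then 1 else 2) * A $ i $ j"
    using sym by (cases "i = j") simp_all
  finally show ?thesis .
qed

text \<open>Centering and linear images stay inside this locale (\<open>translate\<close>,
  \<open>linear_image\<close>), so moment facts proved once serve for the sample point, its
  deviation from the location, and that deviation multiplied by the inverse scale matrix.\<close>

locale second_order_random_vector = prob_space +
  fixes X :: "'a \<Rightarrow> real^'n"
  assumes rv [measurable]: "X \<in> borel_measurable M"
    and square_integrable: "\<And>i. integrable M (\<lambda>\<omega>. (X \<omega> $ i)\<^sup>2)"
begin

lemma component_measurable [measurable]: "(\<lambda>\<omega>. X \<omega> $ i) \<in> borel_measurable M"
  by (rule borel_measurable_continuous_on[OF _ rv]) (intro continuous_intros)

lemma component_integrable: "integrable M (\<lambda>\<omega>. X \<omega> $ i)"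
  by (rule square_integrable_imp_integrable[OF _ square_integrable]) measurable

lemma component_mult_integrable: "integrable M (\<lambda>\<omega>. X \<omega> $ i * X \<omega> $ j)"
proof (rule Bochner_Integration.integrable_bound)
  show "integrable M (\<lambda>\<omega>. (X \<omega> $ i)\<^sup>2 + (X \<omega> $ j)\<^sup>2)"
    by (intro Bochner_Integration.integrable_add square_integrable)
  have "\<bar>a * b\<bar> \<le> a\<^sup>2 + b\<^sup>2" for a b :: real
  proof -
    have "2 * (\<bar>a\<bar> * \<bar>b\<bar>) \<le> a\<^sup>2 + b\<^sup>2"
      using zero_le_power2[of "\<bar>a\<bar> - \<bar>b\<bar>"] by (simp add: power2_diff)
    moreover have "0 \<le> \<bar>a\<bar> * \<bar>b\<bar>" by simp
    ultimately show ?thesis by (simp only: abs_mult)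
  qed
  then show "AE \<omega> in M. norm (X \<omega> $ i * X \<omega> $ j) \<le> norm ((X \<omega> $ i)\<^sup>2 + (X \<omega> $ j)\<^sup>2)"
    by (simp add: abs_mult[symmetric])
qed measurable

lemma vector_integrable: "integrable M X"
proof -
  have "integrable M (\<lambda>\<omega>. \<Sum>i\<in>UNIV. (X \<omega> $ i) *\<^sub>R axis i (1::real))"
    by (intro Bochner_Integration.integrable_sum integrable_scaleR_left component_integrable)
  then show ?thesis
    by (simp add: scalar_mult_eq_scaleR[symmetric] basis_expansion)
qed

lemma expectation_component: "expectation X $ i = expectation (\<lambda>\<omega>. X \<omega> $ i)"
  by (rule integral_bounded_linear[OF bounded_linear_vec_nth vector_integrable, symmetric])

definition second_moment :: "real^'n^'n" where
  "second_moment = (\<chi> i j. expectation (\<lambda>\<omega>. X \<omega> $ i * X \<omega> $ j))"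

lemma transpose_second_moment: "transpose second_moment = second_moment"
  by (simp add: second_moment_def transpose_def vec_eq_iff mult.commute)

lemma inner_matrix_expansion:
  "X \<omega> \<bullet> (A *v X \<omega>) = (\<Sum>i\<in>UNIV. \<Sum>j\<in>UNIV. A $ i $ j * (X \<omega> $ i * X \<omega> $ j))"
  by (simp add: inner_vec_def matrix_vector_mult_def sum_distrib_left mult_ac)

lemma quadratic_form_integrable: "integrable M (\<lambda>\<omega>. X \<omega> \<bullet> (A *v X \<omega>))"
  unfolding inner_matrix_expansion
  by (intro Bochner_Integration.integrable_sum integrable_mult_right component_mult_integrable)

lemma expectation_quadratic_form: "expectation (\<lambda>\<omega>. X \<omega> \<bullet> (A *v X \<omega>)) = trace (A ** second_moment)"
proof -
  have "expectation (\<lambda>\<omega>. X \<omega> \<bullet> (A *v X \<omega>))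
      = (\<Sum>i\<in>UNIV. \<Sum>j\<in>UNIV. A $ i $ j * expectation (\<lambda>\<omega>. X \<omega> $ i * X \<omega> $ j))"
    unfolding inner_matrix_expansion
    by (subst Bochner_Integration.integral_sum Bochner_Integration.integral_sum,
        auto intro!: Bochner_Integration.integrable_sum integrable_mult_right component_mult_integrable
          sum.cong Bochner_Integration.integral_sum[THEN trans])
  then show ?thesis
    by (simp add: trace_def matrix_matrix_mult_def second_moment_def mult.commute)
qed

lemma linear_image: "second_order_random_vector M (\<lambda>\<omega>. A *v X \<omega>)"
proof
  have "continuous_on UNIV ((*v) A)"
    by (intro linear_continuous_on) (simp add: linear_linear[symmetric])
  then have [measurable]: "(*v) A \<in> borel_measurable borel"
    by (rule borel_measurable_continuous_onI)
  show "(\<lambda>\<omega>. A *v X \<omega>) \<in> borel_measurable M"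
    by measurable
  fix i
  \<comment> \<open>The square of a linear form is a quadratic form with a matrix of rank at most
    one, and quadratic forms are already known to be integrable.\<close>
  have "((A *v X \<omega>) $ i)\<^sup>2 = X \<omega> \<bullet> ((\<chi> k l. A $ i $ k * A $ i $ l) *v X \<omega>)" for \<omega>
    unfolding inner_matrix_expansion
    by (simp add: matrix_vector_mult_def power2_eq_square sum_product mult_ac)
  then show "integrable M (\<lambda>\<omega>. ((A *v X \<omega>) $ i)\<^sup>2)"
    using quadratic_form_integrable by simp
qed

lemma translate: "second_order_random_vector M (\<lambda>\<omega>. X \<omega> - c)"
proof
  show "(\<lambda>\<omega>. X \<omega> - c) \<in> borel_measurable M"
    by measurable
  fix i
  have "integrable M (\<lambda>\<omega>. (X \<omega> $ i)\<^sup>2 + (c $ i)\<^sup>2 - 2 * X \<omega> $ i * c $ i)"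
    by (intro Bochner_Integration.integrable_diff Bochner_Integration.integrable_add
        square_integrable integrable_mult_left integrable_mult_right component_integrable) simp
  then show "integrable M (\<lambda>\<omega>. ((X \<omega> - c) $ i)\<^sup>2)"
    by (simp add: power2_diff)
qed

end

lemma (in second_order_random_vector) second_moment_linear_image:
  "second_order_random_vector.second_moment M (\<lambda>\<omega>. A *v X \<omega>) = A ** second_moment ** transpose A"
proof -
  interpret AX: second_order_random_vector M "\<lambda>\<omega>. A *v X \<omega>"
    by (rule linear_image)
  have "AX.second_moment $ i $ j = (A ** second_moment ** transpose A) $ i $ j" for i j
  proof -
    have eq: "(A *v X \<omega>) $ i * (A *v X \<omega>) $ j = X \<omega> \<bullet> ((\<chi> k l. A $ i $ k * A $ j $ l) *v X \<omega>)" for \<omega>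
      unfolding inner_matrix_expansion
      by (simp add: matrix_vector_mult_def sum_product mult_ac)
    have "AX.second_moment $ i $ j = trace ((\<chi> k l. A $ i $ k * A $ j $ l) ** second_moment)"
      by (simp add: AX.second_moment_def eq expectation_quadratic_form)
    also have "\<dots> = (\<Sum>k\<in>UNIV. \<Sum>l\<in>UNIV. A $ i $ k * A $ j $ l * second_moment $ l $ k)"
      by (simp add: trace_def matrix_matrix_mult_def)
    also have "\<dots> = (\<Sum>k\<in>UNIV. \<Sum>l\<in>UNIV. A $ i $ k * A $ j $ l * second_moment $ k $ l)"
      by (intro sum.cong refl) (simp add: second_moment_def mult.commute)
    also have "\<dots> = (\<Sum>l\<in>UNIV. \<Sum>k\<in>UNIV. A $ i $ k * A $ j $ l * second_moment $ k $ l)"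
      by (rule sum.swap)
    also have "\<dots> = (A ** second_moment ** transpose A) $ i $ j"
      by (simp add: matrix_matrix_mult_def transpose_def sum_distrib_left sum_distrib_right mult_ac)
    finally show ?thesis .
  qed
  then show ?thesis by (simp add: vec_eq_iff)
qed

lemma (in second_order_random_vector) second_moment_centered:
  assumes "c = expectation X"
  shows "second_order_random_vector.second_moment M (\<lambda>\<omega>. X \<omega> - c) $ i $ j = second_moment $ i $ j - c $ i * c $ j"
proof -
  interpret Xc: second_order_random_vector M "\<lambda>\<omega>. X \<omega> - c"
    by (rule translate)
  have "Xc.second_moment $ i $ j = expectation (\<lambda>\<omega>. X \<omega> $ i * X \<omega> $ j - c $ j * X \<omega> $ i - c $ i * X \<omega> $ j + c $ i * c $ j)"
    by (simp add: Xc.second_moment_def algebra_simps)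
  also have "\<dots> = second_moment $ i $ j - c $ j * expectation X $ i - c $ i * expectation X $ j + c $ i * c $ j"
    by (simp add: component_integrable component_mult_integrable second_moment_def expectation_component prob_space)
  finally show ?thesis using assms by simp
qed


text \<open>The directional derivative of the log density in direction \<open>h\<close>, multiplied by
  \<open>1 + Q / \<nu>\<close> with \<open>Q\<close> the squared Mahalanobis distance of \<open>x\<close>.\<close>

definition score :: "real \<Rightarrow> ('n::finite) param \<Rightarrow> 'n param \<Rightarrow> real^'n \<Rightarrow> real" where
  "score \<nu> \<eta> h x =
    (let B = matrix_inv (scale_matrix \<eta>); y = B *v (x - location \<eta>) in
      (\<nu> + real CARD('n) - 2) / (2 * \<nu>) * (2 * (location h \<bullet> y) + y \<bullet> (scale_matrix h *v y))
        - (1 + 1 / \<nu> * ((x - location \<eta>) \<bullet> y)) / 2 * trace (B ** scale_matrix h))"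

lemma transpose_matrix_inv_pos_def:
  assumes "pos_def (A :: real^'n^'n)"
  shows "transpose (matrix_inv A) = matrix_inv A"
proof -
  have "transpose (matrix_inv A) ** A = mat 1"
    using pos_def_invertible(1)[OF assms] assms
    by (metis matrix_transpose_mul pos_def_def transpose_mat)
  then show ?thesis
    by (metis pos_def_invertible(1)[OF assms] matrix_mul_assoc matrix_mul_lid matrix_mul_rid)
qed

text \<open>In the variable \<open>B *v (X \<omega> - \<mu>)\<close> the score is a linear form plus
  a quadratic form plus a constant, so its mean depends on the first two moments of that variable
  alone. Conjugation by \<open>A\<close> and \<open>B\<close> translates between its second moments
  and those of the deviation.\<close>

lemma (in second_order_random_vector) score_expectation_zero_iff:
  fixes \<eta> :: "'n param"
  assumes pd: "pos_def (scale_matrix \<eta>)" and \<nu>: "\<nu> > 2"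
  shows score_integrable: "\<And>h. integrable M (\<lambda>\<omega>. score \<nu> \<eta> h (X \<omega>))"
    and "(\<forall>h. expectation (\<lambda>\<omega>. score \<nu> \<eta> h (X \<omega>)) = 0) \<longleftrightarrow>
      location \<eta> = expectation X \<and>
      (\<forall>i j. scale_matrix \<eta> $ i $ j =
        (expectation (\<lambda>\<omega>. X \<omega> $ i * X \<omega> $ j) - location \<eta> $ i * location \<eta> $ j) / (\<nu> / (\<nu> - 2)))"
proof -
  define d where "d = real CARD('n)"
  define \<mu> where "\<mu> = location \<eta>"
  define A where "A = scale_matrix \<eta>"
  define B where "B = matrix_inv A"
  define \<kappa> where "\<kappa> = \<nu> / (\<nu> - 2)"
  have d: "d \<ge> 1" by (simp add: d_def Suc_leI)
  have \<kappa>: "\<kappa> > 0" using \<nu> by (simp add: \<kappa>_def)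
  have AB: "A ** B = mat 1" and BA: "B ** A = mat 1"
    using pos_def_invertible[OF pd] by (simp_all add: A_def B_def)
  have trA: "transpose A = A" and trB: "transpose B = B"
    using transpose_matrix_inv_pos_def[OF pd] by (simp_all add: A_def B_def transpose_scale_matrix)
  interpret Z: second_order_random_vector M "\<lambda>\<omega>. X \<omega> - \<mu>"
    by (rule translate)
  interpret Y: second_order_random_vector M "\<lambda>\<omega>. B *v (X \<omega> - \<mu>)"
    by (rule Z.linear_image)
  let ?y = "\<lambda>\<omega>. B *v (X \<omega> - \<mu>)"
  have z_y: "X \<omega> - \<mu> = A *v ?y \<omega>" for \<omega>
    by (simp add: matrix_vector_mul_assoc AB)
  have Y_Z: "Y.second_moment = B ** Z.second_moment ** B"
    using Z.second_moment_linear_image[of B] by (simp add: trB)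
  have Z_Y: "Z.second_moment = A ** Y.second_moment ** A"
  proof -
    have "A ** Y.second_moment ** A = (A ** B) ** Z.second_moment ** (B ** A)"
      by (simp add: Y_Z matrix_mul_assoc)
    then show ?thesis by (simp add: AB BA)
  qed
  have mean_y: "expectation ?y = B *v (expectation X - \<mu>)"
  proof -
    have "expectation ?y = B *v expectation (\<lambda>\<omega>. X \<omega> - \<mu>)"
      by (rule integral_bounded_linear[OF matrix_vector_mul_bounded_linear Z.vector_integrable])
    then show ?thesis
      by (simp add: vector_integrable prob_space)
  qed
  have mean_y_0: "expectation ?y = 0 \<longleftrightarrow> \<mu> = expectation X"
  proof
    assume "expectation ?y = 0"
    then have "A *v (B *v (expectation X - \<mu>)) = 0" by (simp add: mean_y)
    then show "\<mu> = expectation X" by (simp add: matrix_vector_mul_assoc AB)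
  next
    assume "\<mu> = expectation X"
    then show "expectation ?y = 0" unfolding mean_y by simp
  qed
  have score_eq: "score \<nu> \<eta> h (X \<omega>) =
      (\<nu> + d - 2) / (2 * \<nu>) * (2 * (location h \<bullet> ?y \<omega>) + ?y \<omega> \<bullet> (scale_matrix h *v ?y \<omega>))
        - (1 + 1 / \<nu> * (?y \<omega> \<bullet> (A *v ?y \<omega>))) / 2 * trace (B ** scale_matrix h)" for h \<omega>
    by (simp add: score_def Let_def d_def z_y[symmetric] inner_commute) (simp add: A_def B_def \<mu>_def)
  show integrable: "integrable M (\<lambda>\<omega>. score \<nu> \<eta> h (X \<omega>))" for h
    unfolding score_eq
    by (intro Bochner_Integration.integrable_diff Bochner_Integration.integrable_add integrable_mult_left
        integrable_mult_right integrable_inner_right Y.quadratic_form_integrable Y.vector_integrable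
        integrable_const integrable_divide) 
  define t where "t = trace (A ** Y.second_moment)"
  have E_score: "expectation (\<lambda>\<omega>. score \<nu> \<eta> h (X \<omega>)) =
      (\<nu> + d - 2) / (2 * \<nu>) * (2 * (location h \<bullet> expectation ?y) + trace (scale_matrix h ** Y.second_moment))
        - (1 + 1 / \<nu> * t) / 2 * trace (B ** scale_matrix h)" for h
    unfolding score_eq t_def
    by (simp add: Y.quadratic_form_integrable Y.vector_integrable Y.expectation_quadratic_form prob_space)
  have "(\<forall>h. expectation (\<lambda>\<omega>. score \<nu> \<eta> h (X \<omega>)) = 0) \<longleftrightarrow> \<mu> = expectation X \<and> Z.second_moment = \<kappa> *\<^sub>R A"
  proof (intro iffI conjI allI)
    assume zero: "\<forall>h. expectation (\<lambda>\<omega>. score \<nu> \<eta> h (X \<omega>)) = 0"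
    have "expectation ?y $ i = 0" for i
    proof -
      have "(\<nu> + d - 2) / (2 * \<nu>) * (2 * (axis i 1 \<bullet> expectation ?y)) = 0"
        using zero[rule_format, of "axis (Inl i) 1"] unfolding E_score by (simp add: trace_0[unfolded mat_0])
      then show ?thesis
        using \<nu> d by (simp add: inner_axis')
    qed
    then show "\<mu> = expectation X"
      using mean_y_0 by (simp add: vec_eq_iff)
  next
    assume zero: "\<forall>h. expectation (\<lambda>\<omega>. score \<nu> \<eta> h (X \<omega>)) = 0"
    \<comment> \<open>The scale directions equate multiples of \<open>Y.second_moment\<close> and
      \<open>B\<close> whose ratio involves the still unknown trace \<open>t\<close>;
      \<open>k\<close> is this ratio. Once \<open>Y_k\<close> is known, \<open>t = k * d\<close>
      closes the loop and yields a linear equation for \<open>k\<close>.\<close>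
    define k where "k = (1 + t / \<nu>) * \<nu> / (\<nu> + d - 2)"
    have "Y.second_moment $ i $ j = k * B $ i $ j" for i j
    proof -
      let ?h = "axis (Inr (Upair i j)) 1 :: 'n param"
      let ?f = "if i = j then 1 else 2 :: real"
      have "(\<nu> + d - 2) / (2 * \<nu>) * (?f * Y.second_moment $ i $ j) - (1 + 1 / \<nu> * t) / 2 * (?f * B $ i $ j) = 0"
        using zero[rule_format, of ?h] unfolding E_score trace_mul_sym[of B]
        by (simp add: trace_scale_matrix_axis trB Y.transpose_second_moment)
      then have "?f * ((\<nu> + d - 2) / (2 * \<nu>) * Y.second_moment $ i $ j - (1 + 1 / \<nu> * t) / 2 * B $ i $ j) = 0"
        by (simp add: algebra_simps)
      then have "(\<nu> + d - 2) / (2 * \<nu>) * Y.second_moment $ i $ j = (1 + t / \<nu>) / 2 * B $ i $ j"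
        by (simp split: if_splits)
      moreover have "y = s * \<nu> / e * b" if "e / (2 * \<nu>) * y = s / 2 * b" "e > 0" for y s b e :: real
        using that \<nu> by (simp add: field_simps)
      ultimately show ?thesis
        using \<nu> d unfolding k_def by simp
    qed
    then have Y_k: "Y.second_moment = k *\<^sub>R B"
      by (simp add: vec_eq_iff)
    then have t_k: "t = k * d"
      by (simp add: t_def scaleR_matrix_mult_right AB trace_scaleR trace_I d_def)
    have "k * (\<nu> + d - 2) = (1 + t / \<nu>) * \<nu>"
      using \<nu> d unfolding k_def by (intro nonzero_eq_divide_eq[THEN iffD1] refl) auto
    also have "\<dots> = \<nu> + t"
      using \<nu> by (simp add: distrib_right)
    finally have "k * (\<nu> + d - 2) = \<nu> + t" .
    then have "k * (\<nu> - 2) = \<nu>"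
      by (simp add: t_k algebra_simps)
    then have "k = \<kappa>"
      using \<nu> by (simp add: \<kappa>_def field_simps)
    then show "Z.second_moment = \<kappa> *\<^sub>R A"
      by (simp add: Z_Y Y_k scaleR_matrix_mult_left scaleR_matrix_mult_right AB)
  next
    fix h
    assume "\<mu> = expectation X \<and> Z.second_moment = \<kappa> *\<^sub>R A"
    then have mean: "\<mu> = expectation X" and Z: "Z.second_moment = \<kappa> *\<^sub>R A"
      by blast+
    have Y: "Y.second_moment = \<kappa> *\<^sub>R B"
      by (simp add: Y_Z Z scaleR_matrix_mult_left scaleR_matrix_mult_right BA)
    have t: "t = \<kappa> * d"
      by (simp add: t_def Y scaleR_matrix_mult_right AB trace_scaleR trace_I d_def)
    \<comment> \<open>Both sides equal \<open>(\<nu> + d - 2) / (2 * (\<nu> - 2))\<close>; this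
      equality balances the quadratic term of the score against its trace term.\<close>
    have coeff: "(\<nu> + d - 2) / (2 * \<nu>) * \<kappa> = (1 + 1 / \<nu> * (\<kappa> * d)) / 2"
      using \<nu> by (simp add: \<kappa>_def field_simps)
    have "expectation ?y = 0"
      using mean mean_y_0 by blast
    then show "expectation (\<lambda>\<omega>. score \<nu> \<eta> h (X \<omega>)) = 0"
      unfolding E_score t Y scaleR_matrix_mult_right trace_scaleR trace_mul_sym[of B] coeff[symmetric] by simp
  qed
  also have "\<dots> \<longleftrightarrow> \<mu> = expectation X \<and>
      (\<forall>i j. A $ i $ j = (expectation (\<lambda>\<omega>. X \<omega> $ i * X \<omega> $ j) - \<mu> $ i * \<mu> $ j) / \<kappa>)"
  \<comment> \<open>The second moment of the deviation is the covariance only when \<mu> is the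
    mean, so the first conjunct is used while rewriting the second.\<close>
  proof (rule conj_cong[OF refl])
    assume mean: "\<mu> = expectation X"
    have "Z.second_moment = \<kappa> *\<^sub>R A \<longleftrightarrow> (\<forall>i j. Z.second_moment $ i $ j = \<kappa> * A $ i $ j)"
      by (simp add: vec_eq_iff)
    also have "\<dots> \<longleftrightarrow> (\<forall>i j. A $ i $ j = Z.second_moment $ i $ j / \<kappa>)"
    proof -
      have "b = \<kappa> * a \<longleftrightarrow> a = b / \<kappa>" for a b :: real
        using \<kappa> by (auto simp: field_simps)
      then show ?thesis by (simp only:)
    qed
    finally show "Z.second_moment = \<kappa> *\<^sub>R A \<longleftrightarrow>
        (\<forall>i j. A $ i $ j = (expectation (\<lambda>\<omega>. X \<omega> $ i * X \<omega> $ j) - \<mu> $ i * \<mu> $ j) / \<kappa>)"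
      unfolding second_moment_centered[OF mean] by (simp add: second_moment_def)
  qed
  finally show "(\<forall>h. expectation (\<lambda>\<omega>. score \<nu> \<eta> h (X \<omega>)) = 0) \<longleftrightarrow>
      location \<eta> = expectation X \<and>
      (\<forall>i j. scale_matrix \<eta> $ i $ j =
        (expectation (\<lambda>\<omega>. X \<omega> $ i * X \<omega> $ j) - location \<eta> $ i * location \<eta> $ j) / (\<nu> / (\<nu> - 2)))"
    by (simp only: \<mu>_def A_def \<kappa>_def)
qed

subsection \<open>The Cauchy density\<close>

text \<open>If \<open>transpose T ** A ** T = mat 1\<close>, then the inverse of \<open>A\<close> is
  \<open>T ** transpose T\<close>. The substitution by \<open>transpose T\<close> therefore makes
  the Mahalanobis form Euclidean, and its Jacobian is the reciprocal square root of
  \<open>det A\<close>.\<close>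

lemma pos_def_factorization:
  fixes A :: "real^'n^'n"
  assumes "pos_def A"
  obtains T where "det T \<noteq> 0" "det A = 1 / (det T)\<^sup>2"
    "\<And>x. x \<bullet> (matrix_inv A *v x) = (norm (transpose T *v x))\<^sup>2"
proof -
  obtain T :: "real^'n^'n" where T: "transpose T ** A ** T = mat 1"
    using assms by (rule pos_def_orthonormal_matrix)
  have "det (transpose T ** A ** T) = 1"
    by (simp only: T det_I)
  then have det: "det T * det A * det T = 1"
    by (simp add: det_mul)
  then have "det T \<noteq> 0" by auto
  have "A ** T ** transpose T = mat 1"
    using T matrix_left_right_inverse[of "transpose T" "A ** T"] by (simp add: matrix_mul_assoc)
  then have "matrix_inv A ** (A ** (T ** transpose T)) = matrix_inv A"
    by (simp add: matrix_mul_assoc)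
  then have inv: "matrix_inv A = T ** transpose T"
    by (simp add: matrix_mul_assoc pos_def_invertible[OF assms])
  have "x \<bullet> (matrix_inv A *v x) = (norm (transpose T *v x))\<^sup>2" for x
    unfolding inv matrix_vector_mul_assoc[symmetric]
    by (metis dot_lmul_matrix power2_norm_eq_inner transpose_matrix_vector)
  then show thesis
    using det \<open>det T \<noteq> 0\<close> by (intro that[of T]) (auto simp: field_simps power2_eq_square)
qed

section \<open>Vector integrals and gradients tested direction by direction\<close>

lemma has_bochner_integral_euclidean_zero_iff:
  fixes f :: "'a \<Rightarrow> 'b::euclidean_space"
  shows "has_bochner_integral M f 0 \<longleftrightarrow> (\<forall>h. has_bochner_integral M (\<lambda>x. f x \<bullet> h) 0)"
proof
  assume "has_bochner_integral M f 0"
  then show "\<forall>h. has_bochner_integral M (\<lambda>x. f x \<bullet> h) 0"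
    using has_bochner_integral_inner_left[of _ M f 0] by auto
next
  assume "\<forall>h. has_bochner_integral M (\<lambda>x. f x \<bullet> h) 0"
  then have "has_bochner_integral M (\<lambda>x. \<Sum>b\<in>Basis. (f x \<bullet> b) *\<^sub>R b) (\<Sum>b\<in>Basis. 0 *\<^sub>R b)"
    by (intro has_bochner_integral_sum has_bochner_integral_scaleR_left) auto
  then show "has_bochner_integral M f 0"
    by (simp add: euclidean_representation)
qed

text \<open>A definite description has a usable value only after existence and uniqueness: the Riesz
  vector \<open>G\<close> of the derivative supplies the first, uniqueness of derivatives the
  second.\<close>

lemma inner_gradient:
  fixes f :: "'a::euclidean_space \<Rightarrow> real"
  assumes "(f has_derivative D) (at x)"
  shows "gradient f x \<bullet> h = D h"
proof -
  interpret D: bounded_linear D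
    using assms by (rule has_derivative_bounded_linear)
  define G where "G = (\<Sum>b\<in>Basis. D b *\<^sub>R b)"
  have G: "h \<bullet> G = D h" for h
  proof -
    have "D h = D (\<Sum>b\<in>Basis. (h \<bullet> b) *\<^sub>R b)"
      by (simp add: euclidean_representation)
    then show ?thesis
      by (simp add: D.sum D.scaleR G_def inner_sum_right mult.commute)
  qed
  then have "GDERIV f x :> G"
    using assms by (simp add: gderiv_def)
  moreover have "G' = G" if "GDERIV f x :> G'" for G'
  proof -
    have "(\<lambda>h. h \<bullet> G') = D"
      using that assms unfolding gderiv_def by (rule has_derivative_unique)
    then show ?thesis
      by (metis G inner_commute vector_eq_ldot)
  qed
  ultimately have "gradient f x = G"
    unfolding gradient_def by (rule the_equality)
  then show ?thesis
    using G[of h] by (metis inner_commute)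
qed

text \<open>The parameter \<open>dims\<close> only fixes the type \<open>'n\<close>, through whose
  cardinality the dimension enters the assumptions.\<close>

locale cauchy_model =
  fixes \<beta> \<nu> :: real and dims :: "'n::finite itself"
  assumes \<beta>: "1 < \<beta>" "\<beta> < (real CARD('n) + 2) / real CARD('n)"
    and \<nu>_eq: "1 / \<beta> = 1 - 2 / (\<nu> + real CARD('n))"
begin

lemma \<nu>_gt_2: "\<nu> > 2"
  and exponent: "1 / (1 - \<beta>) = - (\<nu> + real CARD('n) - 2) / 2"
proof -
  define d where "d = real CARD('n)"
  have d: "d > 0" by (simp add: d_def)
  \<comment> \<open>Division by zero gives 0, so \<open>\<nu> + d = 0\<close> would turn the
    relation into \<open>1 / \<beta> = 1\<close>, against \<open>\<beta> > 1\<close>.\<close>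
  have "\<nu> + d \<noteq> 0"
    using \<nu>_eq \<beta>(1) by (auto simp: d_def)
  then have "\<nu> + d = \<beta> * (\<nu> + d - 2)"
    using \<nu>_eq \<beta>(1) by (simp add: d_def field_simps)
  then have 2: "(\<nu> + d - 2) * (\<beta> - 1) = 2"
    by (simp add: algebra_simps)
  have "d * (\<beta> - 1) < 2"
    using \<beta>(2) d by (simp add: d_def[symmetric] field_simps)
  then have "d * (\<beta> - 1) < (\<nu> + d - 2) * (\<beta> - 1)"
    by (simp only: 2)
  then show "\<nu> > 2"
    using \<beta>(1) by simp
  show "1 / (1 - \<beta>) = - (\<nu> + real CARD('n) - 2) / 2"
    unfolding d_def[symmetric] using 2 \<beta>(1) by (simp add: field_simps)
qed

definition mahalanobis :: "'n param \<Rightarrow> real^'n \<Rightarrow> real" where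
  "mahalanobis \<eta> x = (x - location \<eta>) \<bullet> (matrix_inv (scale_matrix \<eta>) *v (x - location \<eta>))"

definition norm_const :: real where
  "norm_const = (LINT y|lborel. (1 + (norm (y :: real^'n))\<^sup>2 / \<nu>) powr (1 / (1 - \<beta>)))"

lemma cauchy_kernel_eq: "cauchy_kernel \<beta> \<nu> \<eta> x = (1 + 1 / \<nu> * mahalanobis \<eta> x) powr (1 / (1 - \<beta>))"
  by (simp add: cauchy_kernel_def mahalanobis_def)

text \<open>Integrability is the crux, since a nonintegrable kernel would have integral 0. By
  \<open>exponent\<close>, the radial criterion becomes \<open>\<nu> > 2\<close>.\<close>

lemma norm_const_pos: "norm_const > 0"
proof -
  let ?f = "\<lambda>y :: real^'n. (1 + (norm y)\<^sup>2 / \<nu>) powr (1 / (1 - \<beta>))"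
  have pos: "1 + (norm y)\<^sup>2 / \<nu> > 0" for y :: "real^'n"
    using \<nu>_gt_2 by (intro add_pos_nonneg) auto
  have int: "integrable lborel ?f"
    unfolding exponent minus_divide_left[symmetric]
    by (rule integrable_one_plus_norm_powr) (use \<nu>_gt_2 in auto)
  have "norm_const \<noteq> 0"
  proof
    assume "norm_const = 0"
    then have "AE y in lborel. ?f y = 0"
      using int by (simp add: norm_const_def integral_nonneg_eq_0_iff_AE)
    then have "AE y in (lborel :: (real^'n) measure). False"
      by eventually_elim (use pos in \<open>simp add: less_imp_neq[symmetric]\<close>)
    then show False
      by (simp add: eventually_False ae_filter_eq_bot_iff)
  qed
  then show ?thesis
    by (simp add: norm_const_def order_less_le integral_nonneg)
qed

context
  fixes \<eta> :: "'n param"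
  assumes pd: "pos_def (scale_matrix \<eta>)"
begin

lemma det_scale_pos: "det (scale_matrix \<eta>) > 0"
  using pos_def_factorization[OF pd] by (metis zero_less_divide_1_iff zero_less_power2)

lemma mahalanobis_nonneg: "mahalanobis \<eta> x \<ge> 0"
  using pos_def_factorization[OF pd] unfolding mahalanobis_def by (metis zero_le_power2)

lemma one_plus_mahalanobis_pos: "1 + 1 / \<nu> * mahalanobis \<eta> x > 0"
  using \<nu>_gt_2 mahalanobis_nonneg by (intro add_pos_nonneg mult_nonneg_nonneg) auto

lemma integral_cauchy_kernel:
  "(LINT y|lborel. cauchy_kernel \<beta> \<nu> \<eta> y) = norm_const * sqrt (det (scale_matrix \<eta>))"
proof -
  obtain T where T: "det T \<noteq> 0" "det (scale_matrix \<eta>) = 1 / (det T)\<^sup>2"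
    "\<And>x. x \<bullet> (matrix_inv (scale_matrix \<eta>) *v x) = (norm (transpose T *v x))\<^sup>2"
    using pos_def_factorization[OF pd] by blast
  define \<phi> where "\<phi> y = (1 + (norm y)\<^sup>2 / \<nu>) powr (1 / (1 - \<beta>))" for y :: "real^'n"
  have [measurable]: "\<phi> \<in> borel_measurable borel"
    unfolding \<phi>_def by measurable
  have "continuous_on UNIV ((*v) (transpose T))"
    by (intro linear_continuous_on) (simp add: linear_linear[symmetric])
  then have [measurable]: "(*v) (transpose T) \<in> borel_measurable borel"
    by (rule borel_measurable_continuous_onI)
  have "(LINT y|lborel. cauchy_kernel \<beta> \<nu> \<eta> y) = (LINT y|lborel. \<phi> (transpose T *v (- location \<eta> + y)))"
    by (simp add: cauchy_kernel_def \<phi>_def T)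
  also have "\<dots> = (LINT y|distr lborel borel ((+) (- location \<eta>)). \<phi> (transpose T *v y))"
    by (rule integral_distr[symmetric]) measurable
  also have "\<dots> = (LINT y|lborel. \<phi> (transpose T *v y))"
    by (simp add: lborel_distr_plus)
  finally have scaled: "\<bar>det T\<bar> * (LINT y|lborel. cauchy_kernel \<beta> \<nu> \<eta> y) = norm_const"
    using integral_lborel_linear(1)[of "(*v) (transpose T)" \<phi>] T(1) by (simp add: norm_const_def \<phi>_def)
  have "\<bar>det T\<bar> * sqrt (det (scale_matrix \<eta>)) = 1"
    using T(1) by (simp add: T(2) real_sqrt_divide)
  moreover have "norm_const * sqrt (det (scale_matrix \<eta>)) =
      (\<bar>det T\<bar> * sqrt (det (scale_matrix \<eta>))) * (LINT y|lborel. cauchy_kernel \<beta> \<nu> \<eta> y)"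
    unfolding scaled[symmetric] by (simp only: mult_ac)
  ultimately show ?thesis by simp
qed

lemma integral_cauchy_kernel_pos: "(LINT y|lborel. cauchy_kernel \<beta> \<nu> \<eta> y) > 0"
  using norm_const_pos det_scale_pos by (simp add: integral_cauchy_kernel)

lemma ln_cauchy_density:
  "ln (cauchy_density \<beta> \<nu> \<eta> x) =
    1 / (1 - \<beta>) * ln (1 + 1 / \<nu> * mahalanobis \<eta> x) - ln norm_const - ln (det (scale_matrix \<eta>)) / 2"
proof -
  have "cauchy_kernel \<beta> \<nu> \<eta> x > 0"
    using one_plus_mahalanobis_pos[of x] by (simp add: cauchy_kernel_eq)
  then have "ln (cauchy_density \<beta> \<nu> \<eta> x) = ln (cauchy_kernel \<beta> \<nu> \<eta> x) - ln (LINT y|lborel. cauchy_kernel \<beta> \<nu> \<eta> y)"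
    unfolding cauchy_density_def
    using integral_cauchy_kernel_pos by (simp add: ln_div)
  also have "ln (cauchy_kernel \<beta> \<nu> \<eta> x) = 1 / (1 - \<beta>) * ln (1 + 1 / \<nu> * mahalanobis \<eta> x)"
    using one_plus_mahalanobis_pos[of x] by (simp add: cauchy_kernel_eq ln_powr)
  also have "ln (LINT y|lborel. cauchy_kernel \<beta> \<nu> \<eta> y) = ln norm_const + ln (det (scale_matrix \<eta>)) / 2"
    using norm_const_pos det_scale_pos by (simp add: integral_cauchy_kernel ln_mult ln_sqrt)
  finally show ?thesis by simp
qed

lemma cauchy_density_powr:
  "cauchy_density \<beta> \<nu> \<eta> x powr (1 - \<beta>) =
    (LINT y|lborel. cauchy_kernel \<beta> \<nu> \<eta> y) powr (\<beta> - 1) * (1 + 1 / \<nu> * mahalanobis \<eta> x)"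
proof -
  let ?Z = "LINT y|lborel. cauchy_kernel \<beta> \<nu> \<eta> y"
  have "cauchy_density \<beta> \<nu> \<eta> x powr (1 - \<beta>) = (1 / ?Z) powr (1 - \<beta>) * cauchy_kernel \<beta> \<nu> \<eta> x powr (1 - \<beta>)"
    unfolding cauchy_density_def by (rule powr_mult)
  also have "(1 / ?Z) powr (1 - \<beta>) = ?Z powr (\<beta> - 1)"
    using integral_cauchy_kernel_pos powr_minus_divide[of ?Z "1 - \<beta>"] by (simp add: powr_divide)
  also have "cauchy_kernel \<beta> \<nu> \<eta> x powr (1 - \<beta>) = 1 + 1 / \<nu> * mahalanobis \<eta> x"
    using one_plus_mahalanobis_pos[of x] \<beta>(1) by (simp add: cauchy_kernel_eq powr_powr)
  finally show ?thesis .
qed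

end

text \<open>The denominator is exactly the factor that \<open>cauchy_density_powr\<close>
  contributes; the other factor there does not depend on \<open>x\<close>. So the weighted gradient
  is a constant times the polynomial \<open>score\<close>.\<close>

lemma inner_gradient_ln_cauchy_density:
  assumes pd: "pos_def (scale_matrix \<eta>)"
  shows "gradient (\<lambda>\<eta>'. ln (cauchy_density \<beta> \<nu> \<eta>' x)) \<eta> \<bullet> h = score \<nu> \<eta> h x / (1 + 1 / \<nu> * mahalanobis \<eta> x)"
proof -
  define y where "y = matrix_inv (scale_matrix \<eta>) *v (x - location \<eta>)"
  define w where "w = 1 + 1 / \<nu> * mahalanobis \<eta> x"
  define \<tau> where "\<tau> h = trace (matrix_inv (scale_matrix \<eta>) ** scale_matrix h)" for h
  have w: "w > 0" using one_plus_mahalanobis_pos[OF pd] by (simp add: w_def)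
  have dQ: "((\<lambda>\<eta>'. mahalanobis \<eta>' x) has_derivative (\<lambda>h. - 2 * (location h \<bullet> y) - y \<bullet> (scale_matrix h *v y))) (at \<eta>)"
    unfolding mahalanobis_def y_def by (rule mahalanobis_has_derivative[OF pd])
  have ddet: "((\<lambda>\<eta>'. det (scale_matrix \<eta>')) has_derivative (\<lambda>h. det (scale_matrix \<eta>) * \<tau> h)) (at \<eta>)"
    unfolding \<tau>_def
    by (rule has_derivative_compose[OF bounded_linear_imp_has_derivative[OF bounded_linear_scale_matrix]])
      (rule det_has_derivative_invertible[OF pos_def_invertible(1)[OF pd]])
  have "((\<lambda>\<eta>'. 1 / (1 - \<beta>) * ln (1 + 1 / \<nu> * mahalanobis \<eta>' x) - ln norm_const - ln (det (scale_matrix \<eta>')) / 2)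
      has_derivative (\<lambda>h. 1 / (1 - \<beta>) * (1 / \<nu> * (- 2 * (location h \<bullet> y) - y \<bullet> (scale_matrix h *v y)) / w) - \<tau> h / 2)) (at \<eta>)"
  proof -
    have "((\<lambda>\<eta>'. 1 + 1 / \<nu> * mahalanobis \<eta>' x) has_derivative
        (\<lambda>h. 1 / \<nu> * (- 2 * (location h \<bullet> y) - y \<bullet> (scale_matrix h *v y)))) (at \<eta>)"
      using has_derivative_add[OF has_derivative_const[of 1] has_derivative_mult_right[OF dQ, of "1 / \<nu>"]] by simp
    then have 1: "((\<lambda>\<eta>'. ln (1 + 1 / \<nu> * mahalanobis \<eta>' x)) has_derivative
        (\<lambda>h. 1 / \<nu> * (- 2 * (location h \<bullet> y) - y \<bullet> (scale_matrix h *v y)) / w)) (at \<eta>)"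
      using has_derivative_ln[of "\<lambda>\<eta>'. 1 + 1 / \<nu> * mahalanobis \<eta>' x" \<eta>] w
      by (simp add: w_def divide_inverse)
    have 2: "((\<lambda>\<eta>'. ln (det (scale_matrix \<eta>'))) has_derivative \<tau>) (at \<eta>)"
    proof -
      have "(\<lambda>h. det (scale_matrix \<eta>) * \<tau> h * inverse (det (scale_matrix \<eta>))) = \<tau>"
        using det_scale_pos[OF pd] by (simp add: fun_eq_iff)
      then show ?thesis
        using has_derivative_ln[OF det_scale_pos[OF pd] ddet] by simp
    qed
    show ?thesis
      using has_derivative_diff[OF has_derivative_diff[OF has_derivative_mult_right[OF 1, of "1 / (1 - \<beta>)"]
            has_derivative_const[of "ln norm_const"]] has_derivative_mult_right[OF 2, of "1 / 2"]] by simp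
  qed
  \<comment> \<open>The explicit logarithm agrees with that of the density only near \<eta>, which
    suffices for the derivative.\<close>
  then have "((\<lambda>\<eta>'. ln (cauchy_density \<beta> \<nu> \<eta>' x))
      has_derivative (\<lambda>h. 1 / (1 - \<beta>) * (1 / \<nu> * (- 2 * (location h \<bullet> y) - y \<bullet> (scale_matrix h *v y)) / w) - \<tau> h / 2)) (at \<eta>)"
    by (rule has_derivative_eventually_nhds)
      (use eventually_pos_def_scale_matrix[OF pd] in eventually_elim, simp add: ln_cauchy_density)
  then have "gradient (\<lambda>\<eta>'. ln (cauchy_density \<beta> \<nu> \<eta>' x)) \<eta> \<bullet> h
      = 1 / (1 - \<beta>) * (1 / \<nu> * (- 2 * (location h \<bullet> y) - y \<bullet> (scale_matrix h *v y)) / w) - \<tau> h / 2"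
    by (rule inner_gradient)
  moreover have "score \<nu> \<eta> h x = (\<nu> + real CARD('n) - 2) / (2 * \<nu>) * (2 * (location h \<bullet> y) + y \<bullet> (scale_matrix h *v y))
        - w / 2 * \<tau> h"
    by (simp add: score_def Let_def y_def w_def \<tau>_def mahalanobis_def)
  moreover have "- e / 2 * (1 / \<nu> * (- 2 * a - b) / w) - t / 2 = (e / (2 * \<nu>) * (2 * a + b) - w / 2 * t) / w"
    for a b t e :: real
    using w \<nu>_gt_2 by (simp add: field_simps)
  ultimately show ?thesis
    unfolding exponent w_def[symmetric] by (simp only:)
qed

end

text \<open>The quadratic form of this matrix at \<open>v\<close> is the mean square of the linear
  form \<open>v \<bullet> (X \<omega> - c)\<close>, and this is 0 only if \<open>X\<close> lies
  almost surely in a hyperplane through \<open>c\<close>.\<close>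

lemma (in second_order_random_vector) pos_def_centered_second_moment:
  assumes nondegenerate: "\<And>v. v \<noteq> 0 \<Longrightarrow> \<not> (AE \<omega> in M. v \<bullet> (X \<omega> - c) = 0)"
  shows "pos_def (second_order_random_vector.second_moment M (\<lambda>\<omega>. X \<omega> - c))"
proof -
  interpret Z: second_order_random_vector M "\<lambda>\<omega>. X \<omega> - c"
    by (rule translate)
  have "v \<bullet> (Z.second_moment *v v) > 0" if "v \<noteq> 0" for v
  proof -
    define A :: "real^'n^'n" where "A = (\<chi> i j. v $ i * v $ j)"
    have sq: "(v \<bullet> (X \<omega> - c))\<^sup>2 = (X \<omega> - c) \<bullet> (A *v (X \<omega> - c))" for \<omega>
      unfolding Z.inner_matrix_expansion
      by (simp add: A_def inner_vec_def power2_eq_square sum_product mult_ac)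
    have int: "integrable M (\<lambda>\<omega>. (v \<bullet> (X \<omega> - c))\<^sup>2)"
      unfolding sq by (rule Z.quadratic_form_integrable)
    have "v \<bullet> (Z.second_moment *v v) = trace (A ** Z.second_moment)"
      by (simp add: A_def inner_vec_def matrix_vector_mult_def trace_def matrix_matrix_mult_def
          sum_distrib_left Z.second_moment_def mult_ac)
    also have "\<dots> = expectation (\<lambda>\<omega>. (v \<bullet> (X \<omega> - c))\<^sup>2)"
      unfolding sq by (rule Z.expectation_quadratic_form[symmetric])
    finally have eq: "v \<bullet> (Z.second_moment *v v) = expectation (\<lambda>\<omega>. (v \<bullet> (X \<omega> - c))\<^sup>2)" .
    have "expectation (\<lambda>\<omega>. (v \<bullet> (X \<omega> - c))\<^sup>2) \<noteq> 0"
      using nondegenerate[OF that] int by (simp add: integral_nonneg_eq_0_iff_AE)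
    then show ?thesis
      unfolding eq by (simp add: order_less_le)
  qed
  then show ?thesis
    by (simp add: pos_def_def Z.transpose_second_moment)
qed

lemma pos_def_scaleR_iff:
  assumes "k > 0"
  shows "pos_def (k *\<^sub>R A) \<longleftrightarrow> pos_def A"
  using assms
  by (simp add: pos_def_def transpose_def vec_eq_iff scaleR_matrix_vector_assoc[symmetric] zero_less_mult_iff)

lemma AE_lborel_not_in_hyperplane:
  fixes v :: "'a::euclidean_space"
  assumes "v \<noteq> 0"
  shows "AE x in lborel. v \<bullet> (x - c) \<noteq> 0"
proof -
  have "negligible {x. v \<bullet> x = v \<bullet> c}"
    using assms by (intro negligible_hyperplane) auto
  then have "{x. v \<bullet> x = v \<bullet> c} \<in> null_sets lborel"
    using closed_hyperplane[of v "v \<bullet> c"] by (simp add: negligible_iff_null_sets null_sets_completion_iff borel_closed)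
  then have "AE x in lborel. x \<notin> {x. v \<bullet> x = v \<bullet> c}"
    by (rule AE_not_in)
  then show ?thesis
    by (simp add: inner_diff_right)
qed

subsection \<open>The escort measure\<close>

locale escort =
  fixes \<beta> :: real and p :: "'a::euclidean_space \<Rightarrow> real"
  assumes p_measurable [measurable]: "p \<in> borel_measurable borel"
    and p_nonneg: "\<And>x. 0 \<le> p x"
    and p_integral: "has_bochner_integral lborel p 1"
    and p_powr_integrable: "integrable lborel (\<lambda>x. p x powr \<beta>)"
begin

lemma integral_powr_pos: "(LINT x|lborel. p x powr \<beta>) > 0"
proof -
  have "(LINT x|lborel. p x powr \<beta>) \<noteq> 0"
  proof
    assume "(LINT x|lborel. p x powr \<beta>) = 0"
    then have "AE x in lborel. p x = 0"
      using p_powr_integrable by (simp add: integral_nonneg_eq_0_iff_AE)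
    then have "(LINT x|lborel. p x) = 0"
      by (rule integral_eq_zero_AE)
    then show False
      using p_integral by (simp add: has_bochner_integral_iff)
  qed
  then show ?thesis
    by (simp add: order_less_le integral_nonneg)
qed

lemma escort_density_nonneg: "escort_density \<beta> p x \<ge> 0"
  using integral_powr_pos by (simp add: escort_density_def)

lemma escort_density_measurable [measurable]: "escort_density \<beta> p \<in> borel_measurable borel"
  unfolding escort_density_def[abs_def] by measurable

lemma sets_escort_measure [simp, measurable_cong]: "sets (escort_measure \<beta> p) = sets borel"
  by (simp add: escort_measure_def)

lemma prob_space_escort: "prob_space (escort_measure \<beta> p)"
proof
  have "emeasure (escort_measure \<beta> p) (space (escort_measure \<beta> p)) = (\<integral>\<^sup>+x. ennreal (escort_density \<beta> p x) \<partial>lborel)"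
    by (simp add: escort_measure_def emeasure_density)
  also have "\<dots> = ennreal (LINT x|lborel. escort_density \<beta> p x)"
    using p_powr_integrable escort_density_nonneg
    by (intro nn_integral_eq_integral) (auto simp: escort_density_def[abs_def])
  also have "(LINT x|lborel. escort_density \<beta> p x) = 1"
    using integral_powr_pos by (simp add: escort_density_def)
  finally show "emeasure (escort_measure \<beta> p) (space (escort_measure \<beta> p)) = 1"
    by simp
qed

text \<open>Since the value of the integral is 0, neither the normalization of the escort density
  nor the factor \<open>c\<close> affects the equation.\<close>

lemma has_bochner_integral_escort_iff:
  fixes f :: "'a \<Rightarrow> real"
  assumes [measurable]: "f \<in> borel_measurable borel" and "c \<noteq> 0"
  shows "has_bochner_integral lborel (\<lambda>x. c * p x powr \<beta> * f x) 0
     \<longleftrightarrow> has_bochner_integral (escort_measure \<beta> p) f 0"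
proof -
  let ?W = "LINT x|lborel. p x powr \<beta>"
  have W: "?W > 0" by (rule integral_powr_pos)
  have int: "integrable (escort_measure \<beta> p) f \<longleftrightarrow> integrable lborel (\<lambda>x. escort_density \<beta> p x * f x)"
    unfolding escort_measure_def using escort_density_nonneg by (subst integrable_density) auto
  have lint: "(LINT x|escort_measure \<beta> p. f x) = (LINT x|lborel. escort_density \<beta> p x * f x)"
    unfolding escort_measure_def using escort_density_nonneg by (subst integral_density) auto
  have eq: "c * p x powr \<beta> * f x = (c * ?W) * (escort_density \<beta> p x * f x)" for x
    using W by (simp add: escort_density_def)
  show ?thesis
    unfolding has_bochner_integral_iff int lint eq using W \<open>c \<noteq> 0\<close> by simp
qed

text \<open>Hyperplanes are Lebesgue null sets; if one carried all the escort mass, \<open>p\<close>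
  would vanish almost everywhere, against its integral 1.\<close>

lemma escort_not_AE_hyperplane:
  assumes "v \<noteq> 0"
  shows "\<not> (AE x in escort_measure \<beta> p. v \<bullet> (x - c) = 0)"
proof
  assume "AE x in escort_measure \<beta> p. v \<bullet> (x - c) = 0"
  then have "AE x in lborel. 0 < ennreal (escort_density \<beta> p x) \<longrightarrow> v \<bullet> (x - c) = 0"
    unfolding escort_measure_def by (subst (asm) AE_density) auto
  with AE_lborel_not_in_hyperplane[OF assms, of c]
  have "AE x in lborel. escort_density \<beta> p x = 0"
    by eventually_elim (use escort_density_nonneg in \<open>auto simp: order_less_le\<close>)
  then have "AE x in lborel. p x = 0"
    using integral_powr_pos by (simp add: escort_density_def)
  then have "(LINT x|lborel. p x) = 0"
    by (rule integral_eq_zero_AE)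
  then show False
    using p_integral by (simp add: has_bochner_integral_iff)
qed

end

text \<open>The equivalence combines solvability with uniqueness: the right side fixes every
  coordinate of \<eta>, since each scale coordinate is an entry of
  \<open>scale_matrix\<close>.\<close>

theorem theorem15:
  fixes \<beta> \<nu> :: real
    and p :: "real ^ 'n \<Rightarrow> real"
    and \<eta> :: "('n::finite) param"
  assumes "1 < \<beta>" and "\<beta> < (real CARD('n) + 2) / real CARD('n)"
    and "1 / \<beta> = 1 - 2 / (\<nu> + real CARD('n))"
    and "continuous_on UNIV p" and "\<And>x. 0 \<le> p x"
    and "has_bochner_integral lborel p 1"
    and "integrable lborel (\<lambda>x. p x powr \<beta>)"
    and "\<And>i. integrable (escort_measure \<beta> p) (\<lambda>x. (x $ i)\<^sup>2)"
  shows "generalized_hellinger_estimator \<beta> p (cauchy_density \<beta> \<nu>) {\<eta>. pos_def (scale_matrix \<eta>)} \<eta> \<longleftrightarrow>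
      location \<eta> = (LINT x|escort_measure \<beta> p. x) \<and>
      (\<forall>i j. scale_matrix \<eta> $ i $ j =
         ((LINT x|escort_measure \<beta> p. x $ i * x $ j) - location \<eta> $ i * location \<eta> $ j)
           / (\<nu> / (\<nu> - 2)))"
    (is "_ \<longleftrightarrow> ?moments")
proof -
  interpret cauchy_model \<beta> \<nu> "TYPE('n)"
    using assms(1-3) by unfold_locales
  interpret escort \<beta> p
    using assms(4-7) by unfold_locales (auto intro: borel_measurable_continuous_onI)
  interpret prob_space "escort_measure \<beta> p"
    by (rule prob_space_escort)
  interpret E: second_order_random_vector "escort_measure \<beta> p" "\<lambda>x. x"
    by unfold_locales (use assms(8) in auto)
  have estimator_iff: "has_bochner_integral lborel
      (\<lambda>x. (p x powr \<beta> * cauchy_density \<beta> \<nu> \<eta> x powr (1 - \<beta>)) *\<^sub>R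
        gradient (\<lambda>\<eta>'. ln (cauchy_density \<beta> \<nu> \<eta>' x)) \<eta>) 0 \<longleftrightarrow> ?moments"
    if pd: "pos_def (scale_matrix \<eta>)"
  proof -
    let ?c = "(LINT y|lborel. cauchy_kernel \<beta> \<nu> \<eta> y) powr (\<beta> - 1)"
    have c: "?c \<noteq> 0"
      using integral_cauchy_kernel_pos[OF pd] by simp
    have integrand: "((p x powr \<beta> * cauchy_density \<beta> \<nu> \<eta> x powr (1 - \<beta>)) *\<^sub>R
        gradient (\<lambda>\<eta>'. ln (cauchy_density \<beta> \<nu> \<eta>' x)) \<eta>) \<bullet> h = ?c * p x powr \<beta> * score \<nu> \<eta> h x" for x h
      using one_plus_mahalanobis_pos[OF pd, of x]
      by (simp add: inner_gradient_ln_cauchy_density[OF pd] cauchy_density_powr[OF pd])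
    have int: "integrable (escort_measure \<beta> p) (score \<nu> \<eta> h)" for h
      using E.score_integrable[OF pd \<nu>_gt_2, of h] by simp
    \<comment> \<open>Measurability is read off from integrability, because the escort measure has
      the Borel sets as its sigma-algebra.\<close>
    then have meas: "score \<nu> \<eta> h \<in> borel_measurable borel" for h
      by (metis borel_measurable_integrable measurable_cong_sets sets_escort_measure)
    have "(\<forall>h. has_bochner_integral (escort_measure \<beta> p) (score \<nu> \<eta> h) 0) \<longleftrightarrow>
        (\<forall>h. expectation (score \<nu> \<eta> h) = 0)"
      unfolding has_bochner_integral_iff using int by blast
    also have "\<dots> \<longleftrightarrow> ?moments"
      by (rule E.score_expectation_zero_iff(2)[OF pd \<nu>_gt_2])
    finally show ?thesis
      by (subst has_bochner_integral_euclidean_zero_iff)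
        (simp only: integrand has_bochner_integral_escort_iff[OF meas c])
  qed
  \<comment> \<open>The estimator must lie in the parameter set, so the moment equations have to
    produce positive definiteness themselves. They make the scale matrix a positive multiple of a
    nondegenerate covariance.\<close>
  have pd_if_moments: "pos_def (scale_matrix \<eta>)" if moments: ?moments
  proof -
    let ?S = "second_order_random_vector.second_moment (escort_measure \<beta> p) (\<lambda>x. x - location \<eta>)"
    have \<kappa>: "\<nu> / (\<nu> - 2) > 0" using \<nu>_gt_2 by simp
    have "pos_def ?S"
      by (rule E.pos_def_centered_second_moment) (rule escort_not_AE_hyperplane)
    moreover have "?S = (\<nu> / (\<nu> - 2)) *\<^sub>R scale_matrix \<eta>"
      using moments E.second_moment_centered[of "location \<eta>"] \<nu>_gt_2
      by (simp add: vec_eq_iff E.second_moment_def)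
    ultimately show ?thesis
      using pos_def_scaleR_iff[OF \<kappa>, of "scale_matrix \<eta>"] by (simp only:)
  qed
  show ?thesis
  proof (cases "pos_def (scale_matrix \<eta>)")
    case True
    then show ?thesis
      unfolding generalized_hellinger_estimator_def mem_Collect_eq estimator_iff[OF True] by (simp only: simp_thms)
  next
    case False
    then have "\<not> ?moments"
      by (rule contrapos_nn) (rule pd_if_moments)
    with False show ?thesis
      unfolding generalized_hellinger_estimator_def mem_Collect_eq by (simp only: simp_thms)
  qed
qed

end
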